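(* Let $\mathbb{C}_K$ be an algebraically closed field, complete with respect to a non-archimedean absolute value $|\cdot|$, whose residue field $\hat{k}$ has characteristic $p>0$. Let $a_0\in\mathbb{C}_K$ with $|a_0|>1$, and let $\varepsilon>0$. Then there is some $a\in\mathbb{C}_K$ with $|a-a_0|\leq\varepsilon$ such that the Fatou set $\mathcal{F}$ of the polynomial $$\phi_a(z)=(1-a)z^{p+1}+az^p$$ has a wandering component.
   Context: The residue field is $\hat{k}=\mathcal{O}_K/\mathcal{M}_K$ with $\mathcal{O}_K=\{x\in\mathbb{C}_K:|x|\le 1\}$ and $\mathcal{M}_K=\{x\in\mathbb{C}_K:|x|<1\}$. Integers such as $p$ are viewed in $\mathbb{C}_K$ via the canonical map $\mathbb{Z}\to\mathbb{C}_K$. On $\mathbb{P}^1(\mathbb{C}_K)=\mathbb{C}_K\cup\{\infty\}$ use the spherical metric $\Delta(x,y)=\frac{|x-y|}{\max\{|x|,1\}\max\{|y|,1\}}$ (extended to $\infty$ in the usual way). For a rational function $\phi$, its Fatou set $\mathcal{F}$ is the set of $x\in\mathbb{P}^1(\mathbb{C}_K)$ at which the family of iterates $\{\phi^n:n\ge0\}$ is equicontinuous with respect to $\Delta$; the Julia set is its complement. Fatou components: for a polynomial $\phi$ of degree at least two with nonempty Julia set and a point $x\in\mathcal{F}$ with bounded forward orbit, the component of $\mathcal{F}$ containing $x$ is the largest closed disk $\{z:|z-x|\le r\}$ containing $x$ and contained in $\mathcal{F}$, and $\phi^n$ maps this component onto the component of $\phi^n(x)$. A component $V$ is wandering if it is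 not preperiodic, i.e. $\phi^m(V)\neq\phi^n(V)$ for all $m\neq n\geq0$. *)

theory Defs
  imports
    "HOL-Algebra.QuotRing"
    "HOL-Algebra.Multiplicative_Group"
    "HOL-Analysis.Abstract_Metric_Spaces"
    "HOL-Computational_Algebra.Polynomial"
begin

hide_const (open) Multiset.mult

locale nonarch_absolute_value =
  fixes v :: "'a::field \<Rightarrow> real"
  assumes nonneg: "0 \<le> v x"
    and eq_zero_iff: "v x = 0 \<longleftrightarrow> x = 0"
    and mult: "v (x * y) = v x * v y"
    and ultrametric: "v (x + y) \<le> max (v x) (v y)"

definition complete_wrt :: "('a::field \<Rightarrow> real) \<Rightarrow> bool" where
  "complete_wrt v \<longleftrightarrow> Metric_space.mcomplete UNIV (\<lambda>x y. v (x - y))"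

definition integer_ring :: "('a::field \<Rightarrow> real) \<Rightarrow> 'a ring" where
  "integer_ring v =
     \<lparr>carrier = {x. v x \<le> 1}, mult = (*), one = 1, zero = 0, add = (+)\<rparr>"

definition maximal_ideal_of :: "('a::field \<Rightarrow> real) \<Rightarrow> 'a set" where
  "maximal_ideal_of v = {x. v x < 1}"

definition residue_field :: "('a::field \<Rightarrow> real) \<Rightarrow> 'a set ring" where
  "residue_field v = integer_ring v Quot maximal_ideal_of v"

text \<open>The additive order of the unit; the library's \<open>group.ord\<close> is 0 for elements of
  infinite order, which is the usual convention for characteristic 0.\<close>

definition ring_characteristic :: "('a, 'b) ring_scheme \<Rightarrow> nat" where
  "ring_characteristic R = group.ord (add_monoid R) \<one>\<^bsub>R\<^esub>"

datatype 'a proj_line = Fin 'a | Infty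

fun spherical_dist ::
  "('a::field \<Rightarrow> real) \<Rightarrow> 'a proj_line \<Rightarrow> 'a proj_line \<Rightarrow> real" where
  "spherical_dist v (Fin x) (Fin y) = v (x - y) / (max (v x) 1 * max (v y) 1)"
| "spherical_dist v (Fin x) Infty = 1 / max (v x) 1"
| "spherical_dist v Infty (Fin y) = 1 / max (v y) 1"
| "spherical_dist v Infty Infty = 0"

fun poly_map :: "'a::field poly \<Rightarrow> 'a proj_line \<Rightarrow> 'a proj_line" where
  "poly_map f (Fin z) = Fin (poly f z)"
| "poly_map f Infty = (if degree f = 0 then Fin (coeff f 0) else Infty)"

definition equicontinuous_iterates_at ::
  "('a::field \<Rightarrow> real) \<Rightarrow> ('a proj_line \<Rightarrow> 'a proj_line) \<Rightarrow> 'a proj_line \<Rightarrow> bool" where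
  "equicontinuous_iterates_at v F x \<longleftrightarrow>
     (\<forall>\<epsilon>>0. \<exists>\<delta>>0. \<forall>y. spherical_dist v x y < \<delta> \<longrightarrow>
        (\<forall>n::nat. spherical_dist v ((F ^^ n) x) ((F ^^ n) y) < \<epsilon>))"

definition fatou_set ::
  "('a::field \<Rightarrow> real) \<Rightarrow> ('a proj_line \<Rightarrow> 'a proj_line) \<Rightarrow> 'a proj_line set" where
  "fatou_set v F = {x. equicontinuous_iterates_at v F x}"

definition julia_set ::
  "('a::field \<Rightarrow> real) \<Rightarrow> ('a proj_line \<Rightarrow> 'a proj_line) \<Rightarrow> 'a proj_line set" where
  "julia_set v F = - fatou_set v F"

definition closed_disk :: "('a::field \<Rightarrow> real) \<Rightarrow> 'a \<Rightarrow> real \<Rightarrow> 'a proj_line set" where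
  "closed_disk v x r = Fin ` {z. v (z - x) \<le> r}"

definition bounded_orbit :: "('a::field \<Rightarrow> real) \<Rightarrow> 'a poly \<Rightarrow> 'a \<Rightarrow> bool" where
  "bounded_orbit v f x \<longleftrightarrow> (\<exists>B. \<forall>n::nat. v ((poly f ^^ n) x) \<le> B)"

text \<open>\<open>V\<close> is the component of the Fatou set containing \<open>x\<close>, i.e. the largest closed disk around
  \<open>x\<close> inside the Fatou set. The notion is only used for polynomials of degree at least two with
  nonempty Julia set and points with bounded orbit; outside of this range there is no \<open>V\<close>.\<close>

definition is_fatou_component_at ::
  "('a::field \<Rightarrow> real) \<Rightarrow> 'a poly \<Rightarrow> 'a \<Rightarrow> 'a proj_line set \<Rightarrow> bool" where
  "is_fatou_component_at v f x V \<longleftrightarrow>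
     degree f \<ge> 2 \<and> julia_set v (poly_map f) \<noteq> {} \<and>
     Fin x \<in> fatou_set v (poly_map f) \<and> bounded_orbit v f x \<and>
     (\<exists>r>0. V = closed_disk v x r) \<and> V \<subseteq> fatou_set v (poly_map f) \<and>
     (\<forall>r>0. closed_disk v x r \<subseteq> fatou_set v (poly_map f) \<longrightarrow> closed_disk v x r \<subseteq> V)"

definition wandering :: "'a::field poly \<Rightarrow> 'a proj_line set \<Rightarrow> bool" where
  "wandering f V \<longleftrightarrow>
     (\<forall>m n::nat. m \<noteq> n \<longrightarrow> (poly_map f ^^ m) ` V \<noteq> (poly_map f ^^ n) ` V)"

definition has_wandering_component :: "('a::field \<Rightarrow> real) \<Rightarrow> 'a poly \<Rightarrow> bool" where
  "has_wandering_component v f \<longleftrightarrow> (\<exists>x V. is_fatou_component_at v f x V \<and> wandering f V)"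

definition phi :: "nat \<Rightarrow> 'a::field \<Rightarrow> 'a poly" where
  "phi p a = monom (1 - a) (p + 1) + monom a p"

context nonarch_absolute_value
begin

lemma v_one [simp]: "v 1 = 1"
  using mult[of 1 1] eq_zero_iff[of 1] by simp

lemma v_zero [simp]: "v 0 = 0"
  by (simp add: eq_zero_iff)

lemma v_minus [simp]: "v (- x) = v x"
proof -
  have "v (-1) * v (-1) = 1" using mult[of "-1" "-1"] by simp
  hence "v (-1) = 1" using nonneg[of "-1"] by (metis abs_of_nonneg abs_mult_self_eq abs_1 power2_eq_iff_nonneg power2_eq_square zero_le_one mult_1)
  thus ?thesis using mult[of "-1" x] by simp
qed

lemma v_diff_commute: "v (x - y) = v (y - x)"
  using v_minus[of "x - y"] by simp

lemma Metric_space_v: "Metric_space UNIV (\<lambda>x y. v (x - y))"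
proof
  fix x y z :: 'a
  show "v (x - z) \<le> v (x - y) + v (y - z)"
    using ultrametric[of "x - y" "y - z"] nonneg[of "x - y"] nonneg[of "y - z"] by simp
qed (auto simp: nonneg eq_zero_iff v_diff_commute)

lemma cring_integer_ring: "cring (integer_ring v)"
proof (rule cringI)
  show "abelian_group (integer_ring v)"
  proof (rule abelian_groupI)
    fix x assume "x \<in> carrier (integer_ring v)"
    then show "\<exists>y\<in>carrier (integer_ring v). y \<oplus>\<^bsub>integer_ring v\<^esub> x = \<zero>\<^bsub>integer_ring v\<^esub>"
      by (intro bexI[of _ "-x"]) (auto simp: integer_ring_def)
  next
    fix x y assume "x \<in> carrier (integer_ring v)" "y \<in> carrier (integer_ring v)"
    then show "x \<oplus>\<^bsub>integer_ring v\<^esub> y \<in> carrier (integer_ring v)"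
      using ultrametric[of x y] by (auto simp: integer_ring_def)
  qed (auto simp: integer_ring_def)
  show "comm_monoid (integer_ring v)"
    by (rule comm_monoidI) (auto simp: integer_ring_def mult nonneg mult_le_one)
qed (auto simp: integer_ring_def algebra_simps)

lemma ideal_maximal_ideal_of: "ideal (maximal_ideal_of v) (integer_ring v)"
proof (rule idealI)
  show "ring (integer_ring v)"
    using cring_integer_ring by (simp add: cring.axioms(1))
  have inv: "inv\<^bsub>add_monoid (integer_ring v)\<^esub> x = - x" if "v x \<le> 1" for x
  proof -
    interpret A: abelian_group "integer_ring v"
      using cring_integer_ring by (simp add: cring_def ring_def)
    show ?thesis
      by (rule group.inv_equality[OF A.a_group]) (use that in \<open>auto simp: integer_ring_def\<close>)
  qed
  show "subgroup (maximal_ideal_of v) (add_monoid (integer_ring v))"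
  proof
    fix x y assume "x \<in> maximal_ideal_of v" "y \<in> maximal_ideal_of v"
    then show "x \<otimes>\<^bsub>add_monoid (integer_ring v)\<^esub> y \<in> maximal_ideal_of v"
      using ultrametric[of x y] by (auto simp: maximal_ideal_of_def integer_ring_def)
  next
    fix x assume "x \<in> maximal_ideal_of v"
    then show "inv\<^bsub>add_monoid (integer_ring v)\<^esub> x \<in> maximal_ideal_of v"
      using inv[of x] by (auto simp: maximal_ideal_of_def)
  qed (auto simp: maximal_ideal_of_def integer_ring_def)
next
  fix a x assume "a \<in> maximal_ideal_of v" "x \<in> carrier (integer_ring v)"
  then have "v (x * a) < 1"
    using mult_right_mono[of "v x" 1 "v a"] by (simp add: maximal_ideal_of_def integer_ring_def mult nonneg)
  then show "x \<otimes>\<^bsub>integer_ring v\<^esub> a \<in> maximal_ideal_of v"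
            "a \<otimes>\<^bsub>integer_ring v\<^esub> x \<in> maximal_ideal_of v"
    by (auto simp: maximal_ideal_of_def integer_ring_def mult.commute)
qed

lemma v_of_nat_le_one: "v (of_nat n) \<le> 1"
proof (induction n)
  case (Suc n)
  then show ?case using ultrametric[of 1 "of_nat n"] by simp
qed simp

lemma residue_characteristic_dvd_iff:
  "ring_characteristic (residue_field v) dvd n \<longleftrightarrow> v (of_nat n) < 1"
proof -
  interpret I: ideal "maximal_ideal_of v" "integer_ring v" by (rule ideal_maximal_ideal_of)
  interpret Q: ring "residue_field v"
    unfolding residue_field_def by (rule I.quotient_is_ring)
  have pow: "\<one>\<^bsub>residue_field v\<^esub> [^]\<^bsub>add_monoid (residue_field v)\<^esub> n
      = maximal_ideal_of v +>\<^bsub>integer_ring v\<^esub> of_nat n" for n :: nat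
  proof (induction n)
    case 0
    have "maximal_ideal_of v +>\<^bsub>integer_ring v\<^esub> \<zero>\<^bsub>integer_ring v\<^esub> = maximal_ideal_of v"
      using I.a_coset_add_zero[OF I.a_subset] by simp
    then show ?case by (simp add: residue_field_def FactRing_def integer_ring_def)
  next
    case (Suc n)
    have "of_nat n \<in> carrier (integer_ring v)" "1 \<in> carrier (integer_ring v)"
      by (auto simp: integer_ring_def v_of_nat_le_one)
    from I.a_rcos_sum[OF this]
    have "(maximal_ideal_of v +>\<^bsub>integer_ring v\<^esub> of_nat n) \<oplus>\<^bsub>residue_field v\<^esub> \<one>\<^bsub>residue_field v\<^esub>
        = maximal_ideal_of v +>\<^bsub>integer_ring v\<^esub> (of_nat n + 1)"
      by (simp add: residue_field_def FactRing_def integer_ring_def)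
    with Suc show ?case by (simp add: add.commute)
  qed
  have "ring_characteristic (residue_field v) dvd n \<longleftrightarrow>
      \<one>\<^bsub>residue_field v\<^esub> [^]\<^bsub>add_monoid (residue_field v)\<^esub> n = \<zero>\<^bsub>residue_field v\<^esub>"
    unfolding ring_characteristic_def
    using group.pow_eq_id[OF Q.a_group, of "\<one>\<^bsub>residue_field v\<^esub>" n] by simp
  also have "\<dots> \<longleftrightarrow> maximal_ideal_of v +>\<^bsub>integer_ring v\<^esub> of_nat n = maximal_ideal_of v"
    by (simp only: pow) (simp add: residue_field_def FactRing_def)
  also have "\<dots> \<longleftrightarrow> of_nat n \<in> maximal_ideal_of v"
    using I.a_coset_join1 I.a_coset_join2 v_of_nat_le_one
    by (metis (no_types, lifting) I.a_rcos_self I.quotient_eq_iff_same_a_r_cos I.a_rcos_const integer_ring_def mem_Collect_eq partial_object.select_convs(1))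
  finally show ?thesis by (simp add: maximal_ideal_of_def)
qed

end

end

theory Submission
  imports Defs "HOL-Computational_Algebra.Primes"
begin

text \<open>
  Write \<open>A = |a0|\<close>. On the open unit disk around the repelling fixed point 1, every \<open>\<phi>\<^sub>a\<close> with
  \<open>|a| = A\<close> expands distances by exactly \<open>A\<close>. Where \<open>|z| < 1\<close> we have \<open>|\<phi>\<^sub>a(z)| = A |z|\<^sup>p\<close>, and
  wild ramification makes \<open>\<phi>\<^sub>a\<close> contract relative distances \<open>|z - w| / |z|\<close> by a fixed factor
  \<open>\<sigma> < 1\<close>. Fix \<open>x \<noteq> 1\<close> with \<open>\<phi>(x) = 1\<close> for the parameter \<open>a0\<close>. Parameters \<open>a\<^sub>i\<close> are
  constructed such that some iterate of \<open>x\<close> is exactly 1. Moving the parameter by about \<open>A\<^sup>2\<^sup>-\<^sup>N\<close>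
  makes the orbit leave the disk around 1 after \<open>N\<close> steps, and a polynomial in \<open>a\<close> that takes
  the value 0 and a value larger than 1 on a disk also takes the value 1, so the orbit can be made
  to spend \<open>M\<close> steps in \<open>|z| < 1\<close> and then hit 1 again. The contraction during these \<open>M\<close> steps
  cancels all earlier dependence on the parameter, so that the construction can be repeated with a
  larger \<open>N\<close>. For the limit parameter, \<open>M\<close> being large compared to \<open>N\<close> keeps a disk around \<open>x\<close>
  bounded under iteration, while the unbounded runs of length \<open>N\<close> near 1 exclude preperiodicity of
  its Fatou component.
\<close>

section \<open>Polynomials on disks\<close>

context nonarch_absolute_value
begin

lemma v_power: "v (x ^ n) = v x ^ n"
  by (induction n) (auto simp: mult)

lemma v_divide: "v (x / y) = v x / v y"
proof (cases "y = 0")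
  case False
  then have "v (x / y) * v y = v x" by (simp flip: mult)
  with False show ?thesis by (simp add: eq_zero_iff field_simps)
qed simp

lemma v_pos_iff: "0 < v x \<longleftrightarrow> x \<noteq> 0"
  using nonneg[of x] eq_zero_iff[of x] by auto

lemma v_diff_le: "v (x - y) \<le> max (v x) (v y)"
  using ultrametric[of x "- y"] by simp

lemma v_diff_triangle: "v (x - z) \<le> max (v (x - y)) (v (y - z))"
  using ultrametric[of "x - y" "y - z"] by simp

lemma v_add_eq_left:
  assumes "v y < v x" shows "v (x + y) = v x"
  using ultrametric[of x y] v_diff_le[of "x + y" y] assms by simp

lemma v_diff_eq_left:
  assumes "v y < v x" shows "v (x - y) = v x"
  using v_add_eq_left[of "- y" x] assms by simp

lemma v_diff_eq_right:
  assumes "v x < v y" shows "v (x - y) = v y"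
  using v_diff_eq_left[OF assms] by (simp add: v_diff_commute)

lemma v_eq_of_close:
  assumes "v (x - y) < v x" shows "v y = v x"
  using v_diff_eq_left[OF assms] by simp

lemma v_diff_eq_of_close:
  assumes "v (y - z) < v (x - y)" shows "v (x - z) = v (x - y)"
  using v_add_eq_left[OF assms] by simp

lemma v_sum_le:
  assumes "finite S" "0 \<le> B" "\<And>i. i \<in> S \<Longrightarrow> v (g i) \<le> B"
  shows "v (sum g S) \<le> B"
  using assms
proof (induction S rule: finite_induct)
  case (insert i S)
  then have "max (v (g i)) (v (sum g S)) \<le> B" by simp
  then show ?case using insert.hyps order_trans[OF ultrametric[of "g i" "sum g S"]] by simp
qed simp

end

section \<open>Zeros and values of polynomials over an algebraically closed field\<close>

locale alg_closed_valuation = nonarch_absolute_value v for v :: "'a::alg_closed_field \<Rightarrow> real"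
begin

lemma v_poly_linear_mult: "v (poly ([:b, - 1:] * q) z) = v (b - z) * v (poly q z)"
  by (simp add: left_diff_distrib flip: mult)

text \<open>In the factorization into linear factors every root \<open>b\<close> lies outside the
  disk, so the ultrametric inequality gives |b - z| = |b - c| factor by factor.\<close>

lemma poly_v_const_of_no_root:
  assumes "\<And>z. v (z - c) \<le> r \<Longrightarrow> poly q z \<noteq> 0" "v (z - c) \<le> r"
  shows "v (poly q z) = v (poly q c)"
  using assms(1)
proof (induction q rule: poly_root_induct[where P = "\<lambda>_. True"])
  case 0
  then show ?case by simp
next
  case (no_roots q)
  then have "degree q = 0" using alg_closed_imp_poly_has_root[of q] by auto
  then show ?case by (auto elim: degree_eq_zeroE)
next
  case (root b q)
  have "\<not> v (b - c) \<le> r" using root.prems[of b] by auto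
  then have "v (z - c) < v (b - c)" using assms(2) by simp
  then have "v (b - z) = v (b - c)"
    using v_diff_eq_of_close[of c z b] by (simp add: v_diff_commute)
  moreover have "v (poly q z) = v (poly q c)"
    using root by auto
  ultimately show ?case by (simp only: v_poly_linear_mult)
qed

text \<open>If \<open>w\<close> were omitted, \<open>q - w\<close> would have constant absolute
  value on the disk, but it is smaller at \<open>c\<close> than at \<open>d\<close>.\<close>

lemma poly_disk_image:
  assumes "v (w - poly q c) < v (poly q d - poly q c)"
  shows "\<exists>z. v (z - c) \<le> v (d - c) \<and> poly q z = w"
proof (rule ccontr)
  assume "\<not> ?thesis"
  then have "v (poly (q - [:w:]) d) = v (poly (q - [:w:]) c)"
    by (intro poly_v_const_of_no_root[where r = "v (d - c)"]) auto
  moreover have "v (poly q d - w) = v (poly q d - poly q c)"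
    using assms by (intro v_diff_eq_of_close) (simp add: v_diff_commute)
  ultimately show False using assms by (simp add: v_diff_commute)
qed

text \<open>Roots of \<open>b\<close> have absolute values above 1 and arbitrarily close to 1, which
  makes the value group dense.\<close>

lemma value_group_dense:
  assumes b: "1 < v b" and "\<alpha> < \<beta>" "0 < \<beta>"
  obtains z where "\<alpha> < v z" "v z < \<beta>"
proof -
  define a where "a = max \<alpha> (\<beta> / 2)"
  have a: "0 < a" "a < \<beta>" "\<alpha> \<le> a" using assms by (auto simp: a_def)
  then have "1 < \<beta> / a" by simp
  then obtain n where n: "v b < (\<beta> / a) ^ n" using real_arch_pow by blast
  have "n > 0" using n b by (cases n) auto
  then obtain c where c: "c ^ n = b" using nth_root_exists by blast
  have cn: "v c ^ n = v b" using c by (simp flip: v_power)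
  have c1: "1 < v c"
    using b \<open>n > 0\<close> power_le_one[of "v c" n] nonneg[of c] unfolding cn[symmetric]
    by (meson leI not_less)
  have c2: "v c < \<beta> / a"
    using n power_less_imp_less_base[of "v c" n "\<beta> / a"] a unfolding cn[symmetric] by simp
  obtain m where m: "1 / a < v b ^ m" using real_arch_pow[OF b] by blast
  have bm: "0 < v b ^ m" using b by simp
  \<comment> \<open>The value for k = 0 lies below \<open>a\<close>; each further factor |c| <
    \<beta> / a is too small to jump over the interval from \<open>a\<close> to \<beta>.\<close>
  define P where "P k \<longleftrightarrow> a < v c ^ k / v b ^ m" for k
  have "\<exists>k. P k"
  proof -
    obtain k where "a * v b ^ m < v c ^ k" using real_arch_pow[OF c1] by blast
    then show ?thesis using bm by (auto simp: P_def field_simps)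
  qed
  then have P: "P (LEAST k. P k)" by (rule LeastI_ex)
  have "\<not> P 0" using m a bm by (simp add: P_def field_simps)
  then obtain k where k: "(LEAST k. P k) = Suc k" using P by (cases "LEAST k. P k") auto
  have "\<not> P k" using k not_less_Least[of k P] by simp
  then have "v c ^ k / v b ^ m * v c \<le> a * v c"
    using c1 by (intro mult_right_mono) (auto simp: P_def)
  also have "\<dots> < \<beta>" using c2 a by (simp add: field_simps)
  finally have "v (c ^ Suc k / b ^ m) < \<beta>" by (simp add: v_divide v_power mult.commute mult)
  moreover have "\<alpha> < v (c ^ Suc k / b ^ m)"
    using P a unfolding k by (simp add: P_def v_divide v_power mult)
  ultimately show ?thesis using that by blast
qed

text \<open>For a linear factor with root \<open>b\<close> and z close to the sphere of radius
  \<open>r\<close>, |b - z| equals |z - c| if |b - c| < r, and |b - c| otherwise. Either way it is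
  at least |z - c| / r times |b - y|. The exponent \<open>k\<close> counts roots, and
  \<open>r1\<close> is at least the distance from \<open>c\<close> of each root in the open
  disk.\<close>

lemma poly_radial_lower_bound:
  assumes "0 < r" "v (y - c) \<le> r"
  shows "\<exists>r1<r. \<exists>k. \<forall>z. r1 < v (z - c) \<and> v (z - c) < r \<longrightarrow>
           (v (z - c) / r) ^ k * v (poly q y) \<le> v (poly q z)"
proof (induction q rule: poly_root_induct[where P = "\<lambda>_. True"])
  case 0
  show ?case using assms by auto
next
  case (no_roots q)
  then have "degree q = 0" using alg_closed_imp_poly_has_root[of q] by auto
  then obtain w where "q = [:w:]" by (auto elim: degree_eq_zeroE)
  then show ?case using assms by (auto intro!: exI[of _ "0::real"] exI[of _ "0::nat"])
next
  case (root b q)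
  then obtain r1 k where r1: "r1 < r" and bound: "\<And>z. r1 < v (z - c) \<Longrightarrow> v (z - c) < r \<Longrightarrow>
      (v (z - c) / r) ^ k * v (poly q y) \<le> v (poly q z)" by blast
  define r2 where "r2 = (if v (b - c) < r then max r1 (v (b - c)) else r1)"
  have "(v (z - c) / r) ^ Suc k * v (poly ([:b, - 1:] * q) y) \<le> v (poly ([:b, - 1:] * q) z)"
    if z: "r2 < v (z - c)" "v (z - c) < r" for z
  proof -
    have 1: "(v (z - c) / r) ^ k * v (poly q y) \<le> v (poly q z)"
      using z by (intro bound) (auto simp: r2_def split: if_splits)
    have 2: "v (z - c) / r * v (b - y) \<le> v (b - z)"
    proof (cases "v (b - c) < r")
      case True
      then have "v (b - c) < v (z - c)" using z by (auto simp: r2_def)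
      then have "v (b - z) = v (z - c)"
        using v_diff_eq_of_close[of c b z] by (simp add: v_diff_commute)
      moreover have "v (b - y) \<le> r"
        using v_diff_triangle[of b y c] True assms by (simp add: v_diff_commute)
      ultimately show ?thesis using assms(1) nonneg[of "z - c"]
        by (simp add: divide_le_eq mult_left_mono)
    next
      case False
      then have "v (b - z) = v (b - c)"
        using v_diff_eq_of_close[of c z b] z by (simp add: v_diff_commute)
      moreover have "v (b - y) \<le> v (b - c)"
        using v_diff_triangle[of b y c] False assms by (simp add: v_diff_commute)
      moreover have "v (z - c) / r \<le> 1" using z assms(1) by simp
      ultimately show ?thesis
        using nonneg mult_mono[of "v (z - c) / r" 1 "v (b - y)" "v (b - z)"] by simp
    qed
    have "((v (z - c) / r) ^ k * v (poly q y)) * (v (z - c) / r * v (b - y))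
        \<le> v (poly q z) * v (b - z)"
      using 1 2 assms(1) nonneg by (intro mult_mono) auto
    then show ?thesis unfolding v_poly_linear_mult by (simp add: mult_ac)
  qed
  moreover have "r2 < r" using r1 by (simp add: r2_def)
  ultimately show ?case by blast
qed

text \<open>A substitute for the maximum modulus principle.\<close>

lemma poly_approx_near_boundary:
  assumes b: "1 < v b" and "0 < r" "v (y - c) \<le> r" "r0 < r" "B < v (poly q y)"
  obtains z where "r0 < v (z - c)" "v (z - c) < r" "B < v (poly q z)"
proof -
  obtain r1 k where r1: "r1 < r" and bound: "\<And>z. r1 < v (z - c) \<Longrightarrow> v (z - c) < r \<Longrightarrow>
      (v (z - c) / r) ^ k * v (poly q y) \<le> v (poly q z)"
    using poly_radial_lower_bound[OF assms(2,3), of q] by blast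
  have "((\<lambda>s. (s / r) ^ k * v (poly q y)) \<longlongrightarrow> (r / r) ^ k * v (poly q y)) (at_left r)"
    by (intro tendsto_intros) (use assms in auto)
  then have "eventually (\<lambda>s. B < (s / r) ^ k * v (poly q y)) (at_left r)"
    by (rule order_tendstoD) (use assms in auto)
  then obtain r2 where r2: "r2 < r" "\<And>s. r2 < s \<Longrightarrow> s < r \<Longrightarrow> B < (s / r) ^ k * v (poly q y)"
    by (auto simp: eventually_at_left[OF assms(4)])
  obtain z where z: "max r0 (max r1 r2) < v z" "v z < r"
    using value_group_dense[OF b, of "max r0 (max r1 r2)" r] assms r1 r2 by auto
  show ?thesis
    using that[of "z + c"] z r2(2)[of "v z"] bound[of "z + c"] by simp
qed

text \<open>The quotient g = (q - q(c)) / (z - c) is a polynomial. If |g(y)| > 1 / r, a value above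
  1 / r also occurs so close to the boundary that |q(z) - q(c)| > 1 there.\<close>

lemma poly_schwarz_lemma:
  assumes b: "1 < v b" and "0 < r" "\<And>z. v (z - c) \<le> r \<Longrightarrow> v (poly q z) \<le> 1" "v (y - c) \<le> r"
  shows "v (poly q y - poly q c) \<le> v (y - c) / r"
proof (rule ccontr)
  assume neg: "\<not> ?thesis"
  then have "y \<noteq> c" by auto
  then have yc: "0 < v (y - c)" by (simp add: v_pos_iff)
  have "[:- c, 1:] dvd q - [:poly q c:]" by (simp add: poly_eq_0_iff_dvd[symmetric])
  then obtain g where "q - [:poly q c:] = [:- c, 1:] * g" by (auto elim: dvdE)
  then have "poly (q - [:poly q c:]) z = poly ([:- c, 1:] * g) z" for z by simp
  then have g: "poly q z - poly q c = (z - c) * poly g z" for z by (simp add: algebra_simps)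
  have "1 / r < v (poly g y)"
    using neg yc \<open>0 < r\<close> unfolding g mult by (simp add: field_simps)
  then obtain B where B: "1 / r < B" "B < v (poly g y)" using dense by blast
  have "0 < 1 / r" using \<open>0 < r\<close> by simp
  then have B0: "0 < B" using B(1) by linarith
  have "1 / B < r" using B(1) B0 \<open>0 < r\<close> by (simp add: divide_less_eq mult.commute)
  obtain z where z: "1 / B < v (z - c)" "v (z - c) < r" "B < v (poly g z)"
    using poly_approx_near_boundary[OF b \<open>0 < r\<close> assms(4) \<open>1 / B < r\<close> B(2)] by blast
  have "1 = 1 / B * B" using B0 by simp
  also have "\<dots> < v (z - c) * v (poly g z)"
    using z B0 nonneg[of "z - c"] by (intro mult_strict_mono') auto
  also have "\<dots> = v (poly q z - poly q c)" by (simp add: g mult)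
  also have "\<dots> \<le> 1"
    using v_diff_le[of "poly q z" "poly q c"] assms(3)[of z] assms(3)[of c] z \<open>0 < r\<close> by simp
  finally show False by simp
qed

end

section \<open>Local behaviour of the family\<close>

context nonarch_absolute_value
begin

lemma v_power_diff_le:
  assumes "v x \<le> B" "v y \<le> B"
  shows "v (x ^ n - y ^ n) \<le> B ^ (n - 1) * v (x - y)"
proof -
  have B: "0 \<le> B" using assms(1) nonneg[of x] by linarith
  have "v (\<Sum>i<n. y ^ (n - Suc i) * x ^ i) \<le> B ^ (n - 1)"
  proof (rule v_sum_le)
    fix i assume "i \<in> {..<n}"
    then have "B ^ (n - 1) = B ^ (n - Suc i) * B ^ i" by (simp flip: power_add)
    then show "v (y ^ (n - Suc i) * x ^ i) \<le> B ^ (n - 1)"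
      using assms B by (simp add: mult v_power mult_mono power_mono nonneg)
  qed (use B in auto)
  then have "v (x - y) * v (\<Sum>i<n. y ^ (n - Suc i) * x ^ i) \<le> v (x - y) * B ^ (n - 1)"
    by (intro mult_left_mono) (auto simp: nonneg)
  then show ?thesis by (simp add: power_diff_sumr2 mult mult.commute)
qed

text \<open>This is the effect of wild ramification. In the binomial expansion around
  \<open>z\<close> the middle terms carry a factor \<open>p\<close>, and the top term gains
  (\<sigma> |z|)^(p-1), which supplies one \<sigma> because p >= 2.\<close>

lemma v_prime_power_diff_le:
  assumes p: "prime p" and \<sigma>: "v (of_nat p) \<le> \<sigma>" "\<sigma> \<le> 1" and zw: "v (w - z) \<le> \<sigma> * v z"
  shows "v (w ^ p - z ^ p) \<le> \<sigma> * v z ^ (p - 1) * v (w - z)"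
proof -
  have \<sigma>0: "0 \<le> \<sigma>" using \<sigma>(1) nonneg[of "of_nat p"] by linarith
  have p2: "2 \<le> p" using p by (rule prime_ge_2_nat)
  have hz: "v (w - z) \<le> v z"
    using zw mult_right_mono[OF \<sigma>(2) nonneg[of z]] by simp
  define h where "h = w - z"
  have "w ^ p = (h + z) ^ p" by (simp add: h_def)
  also have "\<dots> = (\<Sum>k\<le>p. of_nat (p choose k) * h ^ k * z ^ (p - k))" by (rule binomial_ring)
  also have "{..p} = insert 0 {1..p}" by auto
  finally have eq: "w ^ p - z ^ p = (\<Sum>k=1..p. of_nat (p choose k) * h ^ k * z ^ (p - k))"
    by simp
  show ?thesis unfolding eq
  proof (rule v_sum_le)
    show "0 \<le> \<sigma> * v z ^ (p - 1) * v (w - z)" using \<sigma>0 by (simp add: nonneg)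
    fix k assume k: "k \<in> {1..p}"
    then obtain i where i: "k = Suc i" by (cases k) auto
    show "v (of_nat (p choose k) * h ^ k * z ^ (p - k)) \<le> \<sigma> * v z ^ (p - 1) * v (w - z)"
    proof (cases "k = p")
      case True
      have "v h ^ i \<le> (\<sigma> * v z) ^ i" using zw by (intro power_mono) (auto simp: h_def nonneg)
      also have "\<dots> \<le> \<sigma> * v z ^ i"
        using \<sigma>0 \<sigma>(2) p2 True i power_decreasing[of 1 i \<sigma>]
        by (auto simp: power_mult_distrib nonneg intro!: mult_right_mono)
      finally have "v h ^ i * v h \<le> \<sigma> * v z ^ i * v h" by (intro mult_right_mono) (auto simp: nonneg)
      moreover have "p = Suc i" using True i by simp
      ultimately show ?thesis by (simp add: i h_def v_power mult mult.commute)
    next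
      case False
      then have "p dvd (p choose k)" using k p by (intro dvd_choose_prime) auto
      then obtain m where m: "p choose k = p * m" by (auto elim: dvdE)
      have "v (of_nat (p choose k)) \<le> \<sigma> * 1"
        unfolding m of_nat_mult mult using \<sigma>(1) \<sigma>0 v_of_nat_le_one nonneg
        by (intro mult_mono) auto
      moreover have "v h ^ i \<le> v z ^ i" using hz by (intro power_mono) (auto simp: h_def nonneg)
      ultimately have "v (of_nat (p choose k)) * (v h ^ i * (v h * v z ^ (p - k)))
          \<le> \<sigma> * (v z ^ i * (v h * v z ^ (p - k)))"
        using \<sigma>0 by (intro mult_mono mult_right_mono) (auto simp: nonneg)
      moreover have "v z ^ (p - 1) = v z ^ i * v z ^ (p - k)"
        using k i by (simp flip: power_add)
      ultimately show ?thesis by (simp add: i v_power mult mult_ac h_def)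
    qed
  qed auto
qed

end

section \<open>Expansion near 1, contraction near 0, and a second preimage of 1\<close>

locale wild_family = alg_closed_valuation v for v :: "'a::alg_closed_field \<Rightarrow> real" +
  fixes p :: nat and a0 :: 'a
  assumes prime_p: "prime p" and v_p: "v (of_nat p) < 1" and v_a0: "1 < v a0"
begin

text \<open>Written so that the parameter enters only through the summand a z^p (1 - z).\<close>

definition f :: "'a \<Rightarrow> 'a \<Rightarrow> 'a" where
  "f a z = z ^ p * (z + a * (1 - z))"

abbreviation A :: real where "A \<equiv> v a0"

lemma p_ge_2: "2 \<le> p"
  using prime_p by (rule prime_ge_2_nat)

lemma poly_phi: "poly (phi p a) = f a"
  by (auto simp: phi_def f_def poly_monom algebra_simps)

lemma degree_phi:
  assumes "v a = A" shows "degree (phi p a) = p + 1"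
proof -
  have "1 - a \<noteq> 0" using assms v_a0 by auto
  then show ?thesis
    unfolding phi_def
    by (subst degree_add_eq_left)
      (auto simp: degree_monom_eq intro: le_less_trans[OF degree_monom_le])
qed

lemma f_one [simp]: "f a 1 = 1"
  by (simp add: f_def)

lemma f_zero [simp]: "f a 0 = 0"
  using p_ge_2 by (simp add: f_def)

lemma f_diff_param: "v (f a z - f b z) = v (a - b) * v z ^ p * v (1 - z)"
proof -
  have "f a z - f b z = (a - b) * z ^ p * (1 - z)" by (simp add: f_def algebra_simps)
  then show ?thesis by (simp add: mult v_power)
qed

lemma f_diff_param_small:
  assumes "v z < 1" shows "v (f a z - f b z) = v (a - b) * v z ^ p"
  using v_diff_eq_left[of z 1] assms by (simp add: f_diff_param)

lemma v_one_minus_param: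
  assumes "v a = A" shows "v (1 - a) = A"
  using v_diff_eq_right[of 1 a] assms v_a0 by simp

lemma v_f_small:
  assumes "v a = A" "v z < 1" shows "v (f a z) = A * v z ^ p"
proof -
  have "v (1 - z) = 1" using v_diff_eq_left[of z 1] assms by simp
  then have "v (a * (1 - z) + z) = A"
    using v_add_eq_left[of z "a * (1 - z)"] assms v_a0 by (simp add: mult)
  then show ?thesis by (simp add: f_def mult v_power add.commute)
qed

lemma v_f_large:
  assumes "v a = A" "1 < v z" shows "1 < v (f a z)"
proof -
  have "A < A * v z" using assms v_a0 by simp
  then have "v ((1 - a) * z + a) = A * v z"
    using v_add_eq_left[of a "(1 - a) * z"] assms v_one_minus_param by (simp add: mult)
  moreover have "f a z = z ^ p * ((1 - a) * z + a)" by (simp add: f_def algebra_simps)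
  ultimately have "v (f a z) = v z ^ p * (A * v z)" by (simp add: mult v_power)
  moreover have "1 < v z ^ p" using assms p_ge_2 by (intro one_less_power) auto
  moreover have "1 < A * v z" using \<open>A < A * v z\<close> v_a0 by linarith
  ultimately show ?thesis by (simp add: less_1_mult)
qed

lemma f_diff_eq:
  "f a x - f a y = x ^ p * ((1 - a) * (x - y)) + (x ^ p - y ^ p) * (1 + (1 - a) * (y - 1))"
  by (simp add: f_def algebra_simps)

lemma f_lipschitz:
  assumes "v a = A" "v x \<le> 1" "v y \<le> 1"
  shows "v (f a x - f a y) \<le> A * v (x - y)"
proof -
  have "v (1 + (1 - a) * (y - 1)) \<le> max 1 (A * v (y - 1))"
    using ultrametric[of 1 "(1 - a) * (y - 1)"] v_one_minus_param[OF assms(1)] by (simp add: mult)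
  moreover have "A * v (y - 1) \<le> A"
    using v_diff_le[of y 1] assms v_a0 by simp
  ultimately have "v (1 + (1 - a) * (y - 1)) \<le> A" using v_a0 by linarith
  then have "v ((x ^ p - y ^ p) * (1 + (1 - a) * (y - 1))) \<le> v (x - y) * A"
    using v_power_diff_le[OF assms(2,3), of p] unfolding mult
    by (intro mult_mono) (auto simp: nonneg)
  moreover have "v (x ^ p * ((1 - a) * (x - y))) \<le> 1 * (A * v (x - y))"
    unfolding mult v_power v_one_minus_param[OF assms(1)]
    using assms v_a0 by (intro mult_mono power_le_one) (auto simp: nonneg)
  ultimately show ?thesis
    using ultrametric[of "x ^ p * ((1 - a) * (x - y))" "(x ^ p - y ^ p) * (1 + (1 - a) * (y - 1))"]
    by (simp add: f_diff_eq mult.commute)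
qed

lemma v_near_one:
  assumes "v (x - 1) < 1" shows "v x = 1"
  using v_add_eq_left[of "x - 1" 1] assms by simp

text \<open>In \<open>f_diff_eq\<close> the first summand has size exactly A |x - y|, since |x| = 1.
  The second is strictly smaller for x \<noteq> y, because |1 + (1 - a)(y - 1)| < A.\<close>

lemma f_expand:
  assumes "v a = A" "v (x - 1) < 1" "v (y - 1) < 1"
  shows "v (f a x - f a y) = A * v (x - y)"
proof (cases "x = y")
  case False
  then have xy: "0 < v (x - y)" by (simp add: v_pos_iff)
  have "v (1 + (1 - a) * (y - 1)) \<le> max 1 (A * v (y - 1))"
    using ultrametric[of 1 "(1 - a) * (y - 1)"] v_one_minus_param[OF assms(1)] by (simp add: mult)
  moreover have "A * v (y - 1) < A" using assms v_a0 by simp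
  ultimately have B: "v (1 + (1 - a) * (y - 1)) < A" using v_a0 by linarith
  have "v (x ^ p - y ^ p) \<le> v (x - y)"
    using v_power_diff_le[of x 1 y p] v_near_one assms by simp
  then have "v ((x ^ p - y ^ p) * (1 + (1 - a) * (y - 1)))
      \<le> v (x - y) * v (1 + (1 - a) * (y - 1))"
    unfolding mult by (intro mult_right_mono) (auto simp: nonneg)
  also have "\<dots> < v (x - y) * A" using B xy by simp
  also have "\<dots> = v (x ^ p * ((1 - a) * (x - y)))"
    using v_one_minus_param[OF assms(1)] v_near_one[OF assms(2)] by (simp add: mult v_power)
  finally have "v (f a x - f a y) = v (x ^ p * ((1 - a) * (x - y)))"
    unfolding f_diff_eq by (rule v_add_eq_left)
  then show ?thesis
    using v_one_minus_param[OF assms(1)] v_near_one[OF assms(2)] by (simp add: mult v_power)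
qed simp

text \<open>The last factor is |f(z)| / |z|, so relative distances shrink by \<sigma>. For the
  monomial of degree p this is \<open>v_prime_power_diff_le\<close>; for the one of degree p + 1 the
  factor comes from |z| \<le> \<sigma>.\<close>

lemma f_contract:
  assumes a: "v a = A" and \<sigma>: "v (of_nat p) \<le> \<sigma>" "\<sigma> \<le> 1" and z: "v z \<le> \<sigma>"
    and zw: "v (w - z) \<le> \<sigma> * v z"
  shows "v (f a w - f a z) \<le> \<sigma> * v (w - z) * (A * v z ^ (p - 1))"
proof -
  have hz: "v (w - z) \<le> v z"
    using zw mult_right_mono[OF \<sigma>(2) nonneg[of z]] by simp
  have "v w \<le> v z" using ultrametric[of "w - z" z] hz by simp
  then have "v (w ^ Suc p - z ^ Suc p) \<le> v z ^ p * v (w - z)"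
    using v_power_diff_le[of w "v z" z "Suc p"] by simp
  also have "\<dots> = v z * (v z ^ (p - 1) * v (w - z))"
    using p_ge_2 by (cases p) auto
  also have "\<dots> \<le> \<sigma> * (v z ^ (p - 1) * v (w - z))"
    using z by (intro mult_right_mono) (auto simp: nonneg)
  finally have 1: "v ((1 - a) * (w ^ Suc p - z ^ Suc p)) \<le> A * (\<sigma> * (v z ^ (p - 1) * v (w - z)))"
    unfolding mult v_one_minus_param[OF a] using v_a0 by (intro mult_left_mono) auto
  have 2: "v (a * (w ^ p - z ^ p)) \<le> A * (\<sigma> * v z ^ (p - 1) * v (w - z))"
    unfolding mult a using v_prime_power_diff_le[OF prime_p \<sigma> zw] v_a0
    by (intro mult_left_mono) auto
  have "f a w - f a z = a * (w ^ p - z ^ p) + (1 - a) * (w ^ Suc p - z ^ Suc p)"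
    by (simp add: f_def algebra_simps)
  then show ?thesis
    using ultrametric[of "a * (w ^ p - z ^ p)" "(1 - a) * (w ^ Suc p - z ^ Suc p)"] 1 2
    by (simp add: mult_ac)
qed

text \<open>The polynomial minus 1 has the simple zero 1 and degree p + 1, so it has another zero.
  Expansion keeps that zero out of the open unit disk around 1, which determines its absolute
  value.\<close>

lemma ex_preimage_of_one: "\<exists>x. f a0 x = 1 \<and> v x < 1 \<and> A * v x ^ p = 1"
proof -
  define q where "q = phi p a0 - 1"
  have "poly q 1 = 0" by (simp add: q_def poly_phi)
  then obtain g where g: "q = [:- 1, 1:] * g" by (auto simp: poly_eq_0_iff_dvd elim: dvdE)
  have dq: "degree q = p + 1"
    unfolding q_def using degree_phi[of a0] degree_add_eq_left[of "- 1" "phi p a0"] by simp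
  then have "g \<noteq> 0" using g by auto
  then have "degree q = 1 + degree g" unfolding g by (subst degree_mult_eq) auto
  then have "degree g > 0" using dq p_ge_2 by simp
  then obtain x where x: "poly g x = 0" using alg_closed_imp_poly_has_root by blast
  have "x \<noteq> 1"
  proof
    assume "x = 1"
    then have "poly (pderiv q) 1 = 0" using x unfolding g pderiv_mult by (simp add: pderiv_pCons)
    \<comment> \<open>The derivative at 1 cannot vanish, since |p + 1| \<le> 1 < |a0|.\<close>
    then have "of_nat p + 1 - a0 = 0"
      by (simp add: q_def phi_def pderiv_add pderiv_diff pderiv_monom poly_monom algebra_simps)
    then have "of_nat (p + 1) = a0" by (simp add: add.commute)
    then show False using v_a0 v_of_nat_le_one[of "p + 1"] by simp
  qed
  have "poly q x = 0" using x g by simp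
  then have fx: "f a0 x = 1" by (simp add: q_def poly_phi)
  have "v x \<le> 1" using v_f_large[of a0 x] fx by force
  have "\<not> v (x - 1) < 1" using f_expand[of a0 x 1] fx \<open>x \<noteq> 1\<close> v_a0 by (auto simp: eq_zero_iff)
  then have "v (1 - x) = 1" using v_diff_le[of x 1] \<open>v x \<le> 1\<close> by (simp add: v_diff_commute)
  then have "v (a0 * (1 - x) + x) = A"
    using v_add_eq_left[of x "a0 * (1 - x)"] \<open>v x \<le> 1\<close> v_a0 by (simp add: mult)
  then have 1: "A * v x ^ p = 1"
    using arg_cong[OF fx, of v] by (simp add: f_def mult v_power add.commute mult.commute)
  have "v x < 1"
  proof (rule ccontr)
    assume "\<not> v x < 1"
    then have "v x = 1" using \<open>v x \<le> 1\<close> by simp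
    then show False using 1 v_a0 by simp
  qed
  with fx 1 show ?thesis by blast
qed

end

section \<open>Construction of the parameter\<close>

locale wild_orbit = wild_family v p a0 for v :: "'a::alg_closed_field \<Rightarrow> real" and p a0 +
  fixes x :: 'a
  assumes f_x: "f a0 x = 1" and v_x_less: "v x < 1" and v_x_power: "A * v x ^ p = 1"
begin

definition F :: "nat \<Rightarrow> 'a \<Rightarrow> 'a" where
  "F n a = (f a ^^ n) x"

text \<open>A common contraction factor: it covers |p|, from the binomial coefficients, and |x|,
  which bounds the moduli of the orbit during its passages through |z| < 1.\<close>

definition \<sigma> :: real where
  "\<sigma> = max (v (of_nat p)) (v x)"

lemma F_Suc: "F (Suc n) a = f a (F n a)"
  by (simp add: F_def)

text \<open>Makes \<open>poly_disk_image\<close> applicable in the parameter \<open>a\<close>, with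
  \<open>x\<close> held fixed.\<close>

lemma F_poly: "\<exists>q. \<forall>a. poly q a = F n a"
proof (induction n)
  case 0
  show ?case by (intro exI[of _ "[:x:]"]) (simp add: F_def)
next
  case (Suc n)
  then obtain q where "\<forall>a. poly q a = F n a" by blast
  then show ?case
    by (intro exI[of _ "q ^ p * (q + [:0, 1:] * (1 - q))"]) (simp add: F_Suc f_def)
qed

lemma F_add_eq_one: "F n a = 1 \<Longrightarrow> F (n + j) a = 1"
  by (induction j) (auto simp: F_Suc)

lemma F_add_eq_zero: "F n a = 0 \<Longrightarrow> F (n + j) a = 0"
  by (induction j) (auto simp: F_Suc)

lemma sigma_less_1: "\<sigma> < 1"
  by (simp add: \<sigma>_def v_p v_x_less)

lemma v_p_le_sigma: "v (of_nat p) \<le> \<sigma>"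
  by (simp add: \<sigma>_def)

lemma v_x_le_sigma: "v x \<le> \<sigma>"
  by (simp add: \<sigma>_def)

lemma inverse_A_le_sigma: "1 / A \<le> \<sigma>"
proof -
  have "1 / A = v x ^ p" using v_x_power v_a0 by (simp add: field_simps)
  also have "\<dots> \<le> v x ^ 1"
    using p_ge_2 v_x_less by (intro power_decreasing) (auto simp: nonneg)
  finally show ?thesis using v_x_le_sigma by simp
qed

lemma sigma_pos: "0 < \<sigma>"
  using inverse_A_le_sigma v_a0 by (smt (verit) zero_less_divide_1_iff)

text \<open>The upper bound follows from A s(j)^p \<le> 1 = A |x|^p. For the lower one, s \<le> 1 /
  A implies A s^p \<le> A s^2 \<le> s because p >= 2, so the sequence could never climb back to
  1.\<close>

lemma modulus_sequence_bounds:
  fixes s :: "nat \<Rightarrow> real"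
  assumes step: "\<And>j. j < M \<Longrightarrow> s (Suc j) = A * s j ^ p" and nn: "\<And>j. 0 \<le> s j"
    and less: "\<And>j. j < M \<Longrightarrow> s j < 1" and last: "s M = 1" and j: "j < M"
  shows "1 / A < s j" "s j \<le> v x"
proof -
  have "s (Suc j) \<le> 1" using j less[of "Suc j"] last by (cases "Suc j = M") auto
  then have "A * s j ^ p \<le> A * v x ^ p" using step[OF j] v_x_power by simp
  then have "s j ^ p \<le> v x ^ p" using v_a0 by simp
  then show "s j \<le> v x" using p_ge_2 by (subst (asm) power_mono_iff) (auto simp: nonneg nn)
  show "1 / A < s j"
  proof (rule ccontr)
    assume neg: "\<not> 1 / A < s j"
    have "j + i \<le> M \<Longrightarrow> s (j + i) \<le> 1 / A" for i
    proof (induction i)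
      case (Suc i)
      then have IH: "s (j + i) \<le> 1 / A" and lt: "j + i < M" by auto
      have "s (j + i) ^ p = s (j + i) * s (j + i) ^ (p - 1)" using p_ge_2 by (cases p) auto
      also have "\<dots> \<le> s (j + i) * s (j + i) ^ 1"
        using less[OF lt] p_ge_2 nn by (intro mult_left_mono power_decreasing) auto
      also have "\<dots> \<le> 1 / A * s (j + i)" using mult_right_mono[OF IH nn[of "j + i"]] by simp
      finally have "A * s (j + i) ^ p \<le> s (j + i)" using v_a0 by (simp add: field_simps)
      then show ?case using IH step[OF lt] by simp
    qed (use neg in auto)
    from this[of "M - j"] show False using j last v_a0 by simp
  qed
qed

text \<open>The disk condition on \<open>b\<close> is \<open>|b - a| \<le> A\<^sup>2\<^sup>-\<^sup>N\<close>, and \<open>N\<close> is the number of steps the orbit of \<open>x\<close>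
  will subsequently spend near 1.\<close>

definition good :: "nat \<Rightarrow> nat \<Rightarrow> 'a \<Rightarrow> bool" where
  "good N n a \<longleftrightarrow> v a = A \<and> F n a = 1 \<and>
     (\<forall>b c. v (b - a) * A ^ N \<le> A\<^sup>2 \<longrightarrow> v (c - a) * A ^ N \<le> A\<^sup>2 \<longrightarrow>
        A * v (F n b - F n c) = v (b - c))"

section \<open>Dependence of the orbit on the parameter: expansion near 1, then contraction near
  0\<close>

lemma param_modulus:
  assumes "v a = A" "3 \<le> N" "v (b - a) * A ^ N \<le> A\<^sup>2"
  shows "v b = A"
proof -
  have "A ^ 3 \<le> A ^ N" using assms v_a0 by (intro power_increasing) auto
  then have "v (b - a) * A ^ 3 \<le> A\<^sup>2"
    using assms(3) mult_left_mono[OF _ nonneg[of "b - a"], of "A ^ 3" "A ^ N"] by linarith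
  then have "v (b - a) * A \<le> 1" using v_a0 by (simp add: power2_eq_square power3_eq_cube)
  then have "v (b - a) \<le> 1" using v_a0 nonneg[of "b - a"]
    by (smt (verit, best) mult_le_cancel_left1)
  then show ?thesis using v_eq_of_close[of a b] assms(1) v_a0 by (simp add: v_diff_commute)
qed

text \<open>The distance from 1 is A^(j-1) |b - a| < A^(j+1-N) \<le> 1. The third assumption is
  supplied by the induction in \<open>expanding_phase\<close>.\<close>

lemma expanding_phase_near_one:
  assumes "good N n a" "j < N" "A * v (F (n + j) b - F (n + j) a) = A ^ j * v (b - a)"
    "v (b - a) * A ^ N < A\<^sup>2"
  shows "v (F (n + j) b - 1) < 1"
proof -
  have "A * v (F (n + j) b - 1) * A ^ N = A ^ j * (v (b - a) * A ^ N)"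
    using assms F_add_eq_one[of n a j] by (simp add: good_def)
  also have "\<dots> < A ^ j * A\<^sup>2" using assms(4) v_a0 by simp
  also have "\<dots> = A * A ^ Suc j" by (simp add: power2_eq_square)
  also have "\<dots> \<le> A * A ^ N" using assms(2) v_a0 by (intro mult_left_mono power_increasing) auto
  finally show ?thesis using v_a0 by simp
qed

text \<open>Each step multiplies the previous distance by A, while the change of parameter
  contributes less than |b - c| and is dominated.\<close>

lemma expanding_phase:
  assumes good: "good N n a" and N: "3 \<le> N"
    and b: "v (b - a) * A ^ N < A\<^sup>2" and c: "v (c - a) * A ^ N < A\<^sup>2" and "j \<le> N"
  shows "A * v (F (n + j) b - F (n + j) c) = A ^ j * v (b - c)"
  using \<open>j \<le> N\<close> b c
proof (induction j arbitrary: b c)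
  case 0
  then show ?case using good by (simp add: good_def)
next
  case (Suc j)
  \<comment> \<open>The induction hypothesis is applied here to the pair \<open>d\<close>,
    \<open>a\<close>.\<close>
  have near: "v (F (n + j) d - 1) < 1" if "v (d - a) * A ^ N < A\<^sup>2" for d
    using Suc v_a0 that by (intro expanding_phase_near_one[OF good]) auto
  have vb: "v b = A"
    using param_modulus[OF _ N, of a b] good Suc.prems by (simp add: good_def)
  define \<beta> \<gamma> where "\<beta> = F (n + j) b" and "\<gamma> = F (n + j) c"
  have near': "v (\<beta> - 1) < 1" "v (\<gamma> - 1) < 1" unfolding \<beta>_def \<gamma>_def using near Suc.prems by auto
  have IH: "A * v (\<beta> - \<gamma>) = A ^ j * v (b - c)" unfolding \<beta>_def \<gamma>_def using Suc by auto
  have 1: "v (f b \<beta> - f b \<gamma>) = A ^ j * v (b - c)" using f_expand[OF vb near'] IH by simp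
  have "v (f b \<beta> - f c \<gamma>) = A ^ j * v (b - c)"
  proof (cases "b = c")
    case False
    then have bc: "0 < v (b - c)" by (simp add: v_pos_iff)
    have "v (f b \<gamma> - f c \<gamma>) < v (b - c)"
      using near'(2) bc by (simp add: f_diff_param v_near_one v_diff_commute)
    also have "\<dots> \<le> A ^ j * v (b - c)" using v_a0 bc by simp
    finally show ?thesis using v_diff_eq_of_close[of "f b \<gamma>" "f c \<gamma>" "f b \<beta>"] 1 by simp
  qed (use 1 in simp)
  then show ?case by (simp add: F_Suc \<beta>_def \<gamma>_def)
qed

text \<open>The orbits for nearby parameters keep the moduli of the orbit for \<open>a\<close>, so
  their mutual relative distances contract by \<sigma>. After \<open>M\<close> steps only the last
  change of parameter is visible, which restores the exact distance |b - c| / A required by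
  \<open>good\<close>.\<close>

lemma contracting_phase:
  assumes a: "v a = A" and M: "0 < M" and last: "F (m + M) a = 1"
    and small: "\<And>j. j < M \<Longrightarrow> v (F (m + j) a) < 1"
    and expand: "\<And>b c. v (b - a) * A ^ Suc N \<le> 1 \<Longrightarrow> v (c - a) * A ^ Suc N \<le> 1 \<Longrightarrow>
        A * v (F m b - F m c) = A ^ N * v (b - c)"
    and N: "2 \<le> N" and M_large: "\<sigma> ^ M * A ^ Suc N < 1"
  shows "\<And>b j. v (b - a) * A ^ Suc N \<le> 1 \<Longrightarrow> j < M \<Longrightarrow>
           1 / A < v (F (m + j) b) \<and> v (F (m + j) b) \<le> v x"
    and "\<And>b c. v (b - a) * A ^ Suc N \<le> 1 \<Longrightarrow> v (c - a) * A ^ Suc N \<le> 1 \<Longrightarrow>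
           A * v (F (m + M) b - F (m + M) c) = v (b - c)"
proof -
  define s where "s j = v (F (m + j) a)" for j
  have s_Suc: "s (Suc j) = A * s j ^ p" if "j < M" for j
    unfolding s_def using v_f_small[OF a small[OF that]] by (simp add: F_Suc)
  have s: "1 / A < s j" "s j \<le> v x" if "j < M" for j
    using modulus_sequence_bounds[of M s j] s_Suc that small last by (auto simp: s_def nonneg)
  have sM: "s M = 1" using last by (simp add: s_def)
  have s_pos: "0 < s j" if "j \<le> M" for j
    using s[of j] that v_a0 sM by (cases "j = M") (auto intro: less_trans[of 0 "1 / A"])
  have s_split: "A * s j ^ (p - 1) * s j = s (Suc j)" if "j < M" for j
    using s_Suc[OF that] p_ge_2 by (cases p) auto
  have N3: "v (b - a) * A ^ Suc N \<le> 1 \<Longrightarrow> v b = A" for b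
  proof -
    assume "v (b - a) * A ^ Suc N \<le> 1"
    moreover have "1 \<le> A\<^sup>2" using v_a0 by (simp add: one_le_power)
    ultimately show "v b = A" using param_modulus[OF a, of "Suc N" b] N by simp
  qed
  \<comment> \<open>The previous distance contracts, and the change of parameter adds at most |b -
    a| s(j)^p \<le> s(j+1) / A \<le> \<sigma> s(j+1).\<close>
  have close: "v (F (m + j) b - F (m + j) a) \<le> \<sigma> * s j"
    if b: "v (b - a) * A ^ Suc N \<le> 1" and "j \<le> M" for b j
    using \<open>j \<le> M\<close>
  proof (induction j)
    case 0
    \<comment> \<open>The initial distance is at most 1 / A^2, while both \<sigma> and
      \<open>s 0\<close> are at least 1 / A.\<close>
    have "A * (A * v (F m b - F m a)) = v (b - a) * A ^ Suc N"
      using expand[OF b, of a] v_a0 by simp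
    also have "\<dots> \<le> 1" by (rule b)
    finally have "v (F m b - F m a) \<le> 1 / A * (1 / A)" using v_a0 by (simp add: field_simps)
    also have "\<dots> \<le> \<sigma> * s 0"
      using s[OF M] inverse_A_le_sigma v_a0 sigma_pos by (intro mult_mono) auto
    finally show ?case by simp
  next
    case (Suc j)
    then have j: "j < M" by simp
    have IH: "v (F (m + j) b - F (m + j) a) \<le> \<sigma> * v (F (m + j) a)" using Suc by (simp add: s_def)
    have "v (f b (F (m + j) b) - f b (F (m + j) a))
        \<le> \<sigma> * v (F (m + j) b - F (m + j) a) * (A * s j ^ (p - 1))"
      using f_contract[OF N3[OF b] v_p_le_sigma _ _ IH] s[OF j] sigma_less_1 v_x_le_sigma
      by (simp add: s_def)
    also have "\<dots> \<le> \<sigma> * (1 * s j) * (A * s j ^ (p - 1))"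
    proof (intro mult_right_mono mult_left_mono)
      have "\<sigma> * s j \<le> 1 * s j" using sigma_less_1 s_pos[of j] j by (intro mult_right_mono) auto
      then show "v (F (m + j) b - F (m + j) a) \<le> 1 * s j" using IH by (simp add: s_def)
    qed (use sigma_pos v_a0 s_pos[of j] j in auto)
    also have "\<dots> = \<sigma> * s (Suc j)" using s_split[OF j] by (simp add: mult_ac)
    finally have 1: "v (f b (F (m + j) b) - f b (F (m + j) a)) \<le> \<sigma> * s (Suc j)" .
    have "1 \<le> A ^ Suc N" using v_a0 by (intro one_le_power) auto
    then have ba: "v (b - a) \<le> 1"
      using b mult_left_mono[of 1 "A ^ Suc N" "v (b - a)"] nonneg[of "b - a"] by linarith
    have "v (f b (F (m + j) a) - f a (F (m + j) a)) = v (b - a) * s j ^ p"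
      using f_diff_param_small[OF small[OF j]] by (simp add: s_def)
    also have "\<dots> \<le> 1 * s j ^ p" using ba s_pos[of j] j by (intro mult_right_mono) auto
    also have "\<dots> = 1 / A * s (Suc j)" using s_Suc[OF j] v_a0 by simp
    also have "\<dots> \<le> \<sigma> * s (Suc j)"
      using inverse_A_le_sigma s_pos[of "Suc j"] j by (intro mult_right_mono) auto
    finally have 2: "v (f b (F (m + j) a) - f a (F (m + j) a)) \<le> \<sigma> * s (Suc j)" .
    show ?case
      using v_diff_triangle[of "f b (F (m + j) b)" "f a (F (m + j) a)" "f b (F (m + j) a)"] 1 2
      by (simp add: F_Suc)
  qed
  have same: "v (F (m + j) b) = s j" if "v (b - a) * A ^ Suc N \<le> 1" "j \<le> M" for b j
  proof -
    have "\<sigma> * s j < s j" using sigma_less_1 s_pos[OF that(2)] by simp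
    then have "v (F (m + j) b - F (m + j) a) < v (F (m + j) a)"
      using close[OF that] by (simp add: s_def)
    then show ?thesis using v_eq_of_close[of "F (m + j) a" "F (m + j) b"]
      by (simp add: s_def v_diff_commute)
  qed
  show "1 / A < v (F (m + j) b) \<and> v (F (m + j) b) \<le> v x"
    if "v (b - a) * A ^ Suc N \<le> 1" "j < M" for b j
    using same[OF that(1)] s[OF that(2)] that(2) by simp
  show "A * v (F (m + M) b - F (m + M) c) = v (b - c)"
    if b: "v (b - a) * A ^ Suc N \<le> 1" and c: "v (c - a) * A ^ Suc N \<le> 1" for b c
  proof (cases "b = c")
    case False
    then have bc: "0 < v (b - c)" by (simp add: v_pos_iff)
    \<comment> \<open>The first term is the contracted initial distance, the second one comes from the last
      change of parameter, and it dominates at the end of the phase.\<close>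
    define C where "C j = max (\<sigma> ^ j * A ^ N) (1 / A)" for j
    have C_pos: "0 < C j" for j using v_a0 by (simp add: C_def less_max_iff_disj)
    have step: "v (f b (F (m + j) b) - f b (F (m + j) c)) \<le> \<sigma> * (C j * v (b - c)) * s (Suc j)"
      if j: "j < M" and E: "v (F (m + j) b - F (m + j) c) \<le> C j * v (b - c) * s j" for j
    proof -
      have "v (F (m + j) b - F (m + j) c) \<le> \<sigma> * v (F (m + j) c)"
        using v_diff_triangle[of "F (m + j) b" "F (m + j) c" "F (m + j) a"]
          close[OF b, of j] close[OF c, of j] same[OF c, of j] j by (simp add: v_diff_commute)
      then have "v (f b (F (m + j) b) - f b (F (m + j) c))
          \<le> \<sigma> * v (F (m + j) b - F (m + j) c) * (A * s j ^ (p - 1))"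
        using f_contract[OF N3[OF b] v_p_le_sigma, of "F (m + j) c" "F (m + j) b"]
          s[OF j] sigma_less_1 v_x_le_sigma same[OF c, of j] j by simp
      also have "\<dots> \<le> \<sigma> * (C j * v (b - c) * s j) * (A * s j ^ (p - 1))"
        using E sigma_pos v_a0 s_pos[of j] j by (intro mult_right_mono mult_left_mono) auto
      also have "\<dots> = \<sigma> * (C j * v (b - c)) * (A * s j ^ (p - 1) * s j)" by (simp add: mult_ac)
      finally show ?thesis by (simp only: s_split[OF j])
    qed
    have param: "v (f b (F (m + j) c) - f c (F (m + j) c)) = 1 / A * v (b - c) * s (Suc j)"
      if j: "j < M" for j
      using f_diff_param_small[of "F (m + j) c" b c] same[OF c, of j] small[OF j] j s_Suc[OF j] v_a0
      by (simp add: s_def)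
    have E: "v (F (m + j) b - F (m + j) c) \<le> C j * v (b - c) * s j" if "j < M" for j
      using that
    proof (induction j)
      case 0
      have "v (F m b - F m c) = A ^ N * v (b - c) * (1 / A)"
        using expand[OF b c] v_a0 by (simp add: field_simps)
      also have "\<dots> \<le> C 0 * v (b - c) * s 0"
        using s(1)[OF M] v_a0 bc C_pos[of 0] by (intro mult_mono mult_right_mono) (auto simp: C_def)
      finally show ?case by simp
    next
      case (Suc j)
      then have j: "j < M" by simp
      have "\<sigma> * C j \<le> C (Suc j)"
      proof -
        have "\<sigma> * (1 / A) \<le> 1 / A" using sigma_less_1 v_a0 by (simp add: field_simps)
        moreover have "\<sigma> * C j = max (\<sigma> ^ Suc j * A ^ N) (\<sigma> * (1 / A))"
          using sigma_pos by (simp add: C_def max_mult_distrib_left mult.assoc)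
        ultimately show ?thesis unfolding C_def by linarith
      qed
      then have "\<sigma> * (C j * v (b - c)) * s (Suc j) \<le> C (Suc j) * v (b - c) * s (Suc j)"
        using bc s_pos[of "Suc j"] j by (simp flip: mult.assoc)
      moreover have "1 / A * v (b - c) * s (Suc j) \<le> C (Suc j) * v (b - c) * s (Suc j)"
        using bc s_pos[of "Suc j"] j by (intro mult_right_mono) (auto simp: C_def)
      ultimately show ?case
        using step[OF j Suc.IH[OF j]] param[OF j]
          v_diff_triangle[of "f b (F (m + j) b)" "f c (F (m + j) c)" "f b (F (m + j) c)"]
        by (simp add: F_Suc)
    qed
    obtain j where j: "M = Suc j" using M by (cases M) auto
    \<comment> \<open>With \<open>M = Suc j\<close>, the size of \<open>M\<close> makes the
      inherited distance strictly smaller than the parameter term in the last step.\<close>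
    have "\<sigma> * C j < 1 / A"
    proof -
      have "\<sigma> * (1 / A) < 1 / A" using sigma_less_1 v_a0 by (simp add: field_simps)
      moreover have "\<sigma> * (\<sigma> ^ j * A ^ N) < 1 / A"
        using M_large v_a0 by (simp add: j field_simps)
      ultimately show ?thesis using sigma_pos by (simp add: C_def max_mult_distrib_left)
    qed
    then have "\<sigma> * (C j * v (b - c)) * s (Suc j) < 1 / A * v (b - c) * s (Suc j)"
      using mult_strict_right_mono[OF _ bc, of "\<sigma> * C j" "1 / A"] sM by (simp add: j mult.assoc)
    then have "v (f b (F (m + j) b) - f b (F (m + j) c)) < v (f b (F (m + j) c) - f c (F (m + j) c))"
      using step[OF _ E, of j] param[of j] j by simp
    then have "v (f b (F (m + j) b) - f c (F (m + j) c)) = v (f b (F (m + j) c) - f c (F (m + j) c))"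
      using v_add_eq_left[of "f b (F (m + j) b) - f b (F (m + j) c)"
          "f b (F (m + j) c) - f c (F (m + j) c)"] by simp
    then show ?thesis using param[of j] sM v_a0 by (simp add: j F_Suc)
  qed simp
qed

section \<open>The inductive step of the construction\<close>

definition itinerary :: "nat \<Rightarrow> nat \<Rightarrow> nat \<Rightarrow> 'a \<Rightarrow> bool" where
  "itinerary n N M a \<longleftrightarrow> (\<forall>j<N. v (F (n + j) a - 1) < 1) \<and>
     (\<forall>j<M. 1 / A < v (F (n + N + j) a) \<and> v (F (n + N + j) a) \<le> v x)"

text \<open>Solving A s^p = |c| backwards stays inside the value group, by taking p-th roots of
  \<open>c / a0\<close>, and stays below 1.\<close>

lemma ex_backward_modulus:
  assumes "c \<noteq> 0" "v c < 1"
  shows "\<exists>y. v y < 1 \<and> ((\<lambda>s. A * s ^ p) ^^ m) (v y) = v c"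
  using assms
proof (induction m arbitrary: c)
  case 0
  then show ?case by auto
next
  case (Suc m)
  obtain y where y: "y ^ p = c / a0" using nth_root_exists[of p "c / a0"] p_ge_2 by auto
  then have "v y ^ p = v c / A" by (simp flip: v_power v_divide)
  then have yc: "A * v y ^ p = v c" using v_a0 by simp
  have "y \<noteq> 0" using y Suc.prems v_a0 p_ge_2 by (auto simp: power_0_left)
  moreover have "v y < 1"
  proof (rule ccontr)
    assume "\<not> v y < 1"
    then have "1 * 1 \<le> A * v y ^ p" using v_a0 by (intro mult_mono one_le_power) auto
    then show False using yc Suc.prems by simp
  qed
  ultimately obtain z where "v z < 1" "((\<lambda>s. A * s ^ p) ^^ m) (v z) = v y"
    using Suc.IH by blast
  then show ?case using yc by auto
qed

text \<open>At time \<open>m\<close>, the end of the run near 1, the parameter is moved to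
  \<open>a1\<close>, whose orbit hits 0. On a disk around \<open>a1\<close> the iterate at time
  \<open>m + M\<close> takes the value 0 and a value of modulus above 1, hence also the value 1, at
  some \<open>a'\<close>.\<close>

lemma ex_next_parameter:
  assumes good: "good N n a" and N: "3 \<le> N"
  shows "\<exists>a' M. 0 < M \<and> good (N + 3) (n + N + M) a' \<and> \<sigma> ^ M * A ^ (N + 4) \<le> 1 \<and>
    v (a' - a) * A ^ N \<le> A\<^sup>2 \<and> (\<forall>b. v (b - a') * A ^ Suc N \<le> 1 \<longrightarrow> itinerary n N M b)"
proof -
  have va: "v a = A" and Fa: "F n a = 1" using good by (auto simp: good_def)
  have AN: "0 < A ^ k" for k using v_a0 by simp
  define m where "m = n + N"
  have expand: "A * v (F m b - F m c) = A ^ N * v (b - c)"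
    if "v (b - a) * A ^ N < A\<^sup>2" "v (c - a) * A ^ N < A\<^sup>2" for b c
    using expanding_phase[OF good N that, of N] by (simp add: m_def)
  have A2: "A < A\<^sup>2" using v_a0 by (simp add: power2_eq_square)
  have Fma: "F m a = 1" using F_add_eq_one[OF Fa] by (simp add: m_def)
  obtain q where q: "\<And>b. poly q b = F m b" using F_poly by metis
  \<comment> \<open>The exponent is one more than \<open>N + 3\<close>, the length of the next run
    near 1.\<close>
  obtain M where M: "\<sigma> ^ M < 1 / A ^ (N + 4)"
    using real_arch_pow_inv[of "1 / A ^ (N + 4)" \<sigma>] sigma_less_1 v_a0 by auto
  have "0 < M"
  proof (rule ccontr)
    assume "\<not> 0 < M"
    moreover have "1 / A ^ (N + 4) \<le> 1" using v_a0 by (simp add: one_le_power del: power_Suc)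
    ultimately show False using M by simp
  qed
  then obtain M1 where M1: "M = Suc M1" by (cases M) auto
  obtain q' where q': "\<And>b. poly q' b = F (m + M) b" using F_poly by metis

  \<comment> \<open>A parameter for which the orbit reaches 0 at time \<open>m\<close>.\<close>
  obtain e where e: "A / A ^ N < v e" "v e < A\<^sup>2 / A ^ N"
    using value_group_dense[OF v_a0, of "A / A ^ N" "A\<^sup>2 / A ^ N"] A2 AN v_a0
    by (auto simp: divide_strict_right_mono)
  then have e': "A < v e * A ^ N" "v e * A ^ N < A\<^sup>2" using AN by (auto simp: field_simps)
  \<comment> \<open>Since A^N |e| > A, the iterate moves from 1 by more than 1, so its image of the
    disk of radius |e| contains 0.\<close>
  have "A * v (F m (a + e) - F m a) = A ^ N * v e" using expand[of "a + e" a] e' v_a0 by simp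
  then have "A * 1 < A * v (F m (a + e) - F m a)" using e' by (simp add: mult.commute)
  then have "1 < v (F m (a + e) - F m a)" using v_a0 by (simp only: mult_less_cancel_left_pos)
  then obtain a1 where a1: "v (a1 - a) \<le> v e" "F m a1 = 0"
    using poly_disk_image[of 0 q a "a + e"] by (auto simp: q Fma)
  have a1': "v (a1 - a) * A ^ N < A\<^sup>2"
    by (rule le_less_trans[OF mult_right_mono[OF a1(1)] e'(2)]) (use AN[of N] in simp)

  \<comment> \<open>A value of \<open>|F m b|\<close> that stays below 1 for \<open>M - 1\<close> steps and exceeds 1 after \<open>M\<close> steps.\<close>
  obtain c where c: "c ^ (p + 1) = 1 / a0" using nth_root_exists[of "p + 1" "1 / a0"] by auto
  then have vc: "v c ^ (p + 1) = 1 / A" unfolding v_power[symmetric] by (simp only: v_divide v_one)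
  have c0: "c \<noteq> 0" using c v_a0 by auto
  have c1: "v c < 1"
  proof (rule ccontr)
    assume "\<not> v c < 1"
    then have "1 \<le> v c ^ (p + 1)" by (intro one_le_power) auto
    then show False using vc v_a0 by simp
  qed
  have c2: "1 < A * v c ^ p"
  proof -
    have "A * v c ^ p * v c = 1" using vc v_a0 by (simp add: mult_ac)
    moreover have "0 < A * v c ^ p" using c0 v_pos_iff[of c] v_a0 by simp
    ultimately show ?thesis using c1 mult_strict_left_mono[of "v c" 1 "A * v c ^ p"] by simp
  qed
  obtain y where y: "v y < 1" "((\<lambda>s. A * s ^ p) ^^ M1) (v y) = v c"
    using ex_backward_modulus[OF c0 c1] by blast
  define s where "s j = ((\<lambda>s. A * s ^ p) ^^ j) (v y)" for j
  have s_nonneg: "0 \<le> s j" for j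
    using v_a0 by (induction j) (auto simp: s_def nonneg)
  have s_less: "s j < 1" if "j \<le> M1" for j
  proof (rule ccontr)
    assume neg: "\<not> s j < 1"
    have "1 \<le> s (j + i)" for i
    proof (induction i)
      case (Suc i)
      then have "1 * 1 \<le> A * s (j + i) ^ p" using v_a0 by (intro mult_mono one_le_power) auto
      then show ?case by (simp add: s_def)
    qed (use neg in simp)
    from this[of "M1 - j"] show False using that y(2) c1 by (simp add: s_def)
  qed
  \<comment> \<open>By monotonicity of A s^p, every parameter whose orbit starts at modulus at most
    |y| stays below 1 for the first \<open>M\<close> points; this will apply to
    \<open>a'\<close>.\<close>
  have orbit_le: "v (F (m + j) b) \<le> s j"
    if "v b = A" "v (F m b) \<le> v y" "j \<le> M1" for b j
    using that(3)
  proof (induction j)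
    case (Suc j)
    then have IH: "v (F (m + j) b) \<le> s j" by simp
    moreover have "s j < 1" using s_less Suc.prems by simp
    ultimately have "v (F (m + Suc j) b) = A * v (F (m + j) b) ^ p"
      using v_f_small[OF that(1)] by (simp add: F_Suc)
    also have "\<dots> \<le> A * s j ^ p" using IH v_a0 by (intro mult_left_mono power_mono) (auto simp: nonneg)
    finally show ?case by (simp add: s_def)
  qed (use that in \<open>simp add: s_def\<close>)
  have orbit_eq: "v (F (m + j) b) = s j"
    if "v b = A" "v (F m b) = v y" "j \<le> M1" for b j
    using that(3)
  proof (induction j)
    case (Suc j)
    then have IH: "v (F (m + j) b) = s j" by simp
    moreover have "s j < 1" using s_less Suc.prems by simp
    ultimately have "v (F (m + Suc j) b) = A * s j ^ p"
      using v_f_small[OF that(1), of "F (m + j) b"] by (simp add: F_Suc)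
    then show ?case by (simp add: s_def)
  qed (use that in \<open>simp add: s_def\<close>)

  \<comment> \<open>The distance |d - a1| = A |y| / A^N is the one that expansion turns into |F m d|
    = |y|.\<close>
  define d where "d = a1 + a0 * y / a0 ^ N"
  have d: "v (d - a1) * A ^ N = A * v y"
    using v_a0 by (simp add: d_def v_divide v_power mult)
  have "A * v y \<le> A" using y(1) v_a0 by simp
  have in_disk: "v (b - a) * A ^ N < A\<^sup>2" if "v (b - a1) * A ^ N \<le> A" for b
  proof -
    have "v (b - a) * A ^ N \<le> max (v (b - a1)) (v (a1 - a)) * A ^ N"
      using v_diff_triangle[of b a a1] AN[of N] by (intro mult_right_mono) auto
    also have "\<dots> < A\<^sup>2" using that a1' A2 by (simp add: max_def)
    finally show ?thesis .
  qed
  have d': "v (d - a) * A ^ N < A\<^sup>2" using in_disk[of d] d \<open>A * v y \<le> A\<close> by simp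
  have vd: "v d = A" by (rule param_modulus[OF va N less_imp_le[OF d']])
  have "A * v (F m d) = A * v y" using expand[OF d' a1'] a1(2) d by (simp add: mult.commute)
  then have vFd: "v (F m d) = v y" using v_a0 by simp
  have "v (F (m + M1) d) = v c" using orbit_eq[OF vd vFd, of M1] y(2) by (simp add: s_def)
  then have "v (F (m + M) d) = A * v c ^ p"
    using v_f_small[OF vd, of "F (m + M1) d"] c1 by (simp add: M1 F_Suc)
  then have "1 < v (F (m + M) d)" using c2 by simp
  moreover have "F (m + M) a1 = 0" using F_add_eq_zero[OF a1(2)] by simp
  ultimately obtain a' where a': "v (a' - a1) \<le> v (d - a1)" "F (m + M) a' = 1"
    using poly_disk_image[of 1 q' a1 d] by (auto simp: q')
  have a'1: "v (a' - a1) * A ^ N \<le> A * v y"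
    using mult_right_mono[OF a'(1), of "A ^ N"] AN[of N] d by simp
  have a'a: "v (a' - a) * A ^ N < A\<^sup>2" using in_disk[of a'] a'1 \<open>A * v y \<le> A\<close> by simp
  have va': "v a' = A" by (rule param_modulus[OF va N less_imp_le[OF a'a]])
  have "A * v (F m a') \<le> A * v y" using expand[OF a'a a1'] a1(2) a'1 by (simp add: mult.commute)
  then have Fa': "v (F m a') \<le> v y" using v_a0 by simp
  have small: "v (F (m + j) a') < 1" if "j < M" for j
    using orbit_le[OF va' Fa', of j] s_less[of j] that by (simp add: M1)
  have "v (F m a' - 1) \<le> 1" using v_diff_le[of "F m a'" 1] Fa' y(1) by simp
  then have "A * v (F m a' - 1) \<le> A * 1" using v_a0 by (intro mult_left_mono) auto
  moreover have "v (a' - a) * A ^ N = A * v (F m a' - 1)"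
    using expand[OF a'a, of a] v_a0 by (simp add: Fma mult.commute)
  ultimately have a'_close: "v (a' - a) * A ^ N \<le> A" by linarith
  have near: "v (b - a) * A ^ N \<le> A" if "v (b - a') * A ^ Suc N \<le> 1" for b
  proof -
    have "v (b - a') * A ^ N * 1 \<le> v (b - a') * A ^ N * A"
      using v_a0 AN[of N] by (intro mult_left_mono) (auto simp: nonneg)
    also have "\<dots> = v (b - a') * A ^ Suc N" by simp
    finally have "v (b - a') * A ^ N \<le> A" using that v_a0 by linarith
    moreover have "v (b - a) * A ^ N \<le> max (v (b - a')) (v (a' - a)) * A ^ N"
      using v_diff_triangle[of b a a'] AN[of N] by (intro mult_right_mono) auto
    ultimately show ?thesis using a'_close by (simp add: max_def split: if_splits)
  qed
  have "\<sigma> ^ M * A ^ (N + 4) < 1" using M AN by (simp add: field_simps)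
  have M_large: "\<sigma> ^ M * A ^ Suc N < 1"
  proof -
    have "\<sigma> ^ M * A ^ Suc N \<le> \<sigma> ^ M * A ^ (N + 4)"
      using sigma_pos v_a0 by (intro mult_left_mono power_increasing) auto
    then show ?thesis using \<open>\<sigma> ^ M * A ^ (N + 4) < 1\<close> by simp
  qed
  have ex': "A * v (F m b - F m c) = A ^ N * v (b - c)"
    if "v (b - a') * A ^ Suc N \<le> 1" "v (c - a') * A ^ Suc N \<le> 1" for b c
    using near[OF that(1)] near[OF that(2)] A2 by (intro expand) auto
  note contracting = contracting_phase[OF va' \<open>0 < M\<close> a'(2) small ex' _ M_large]
  have "good (N + 3) (n + N + M) a'"
  proof -
    \<comment> \<open>The increment 3 makes the disk in \<open>good\<close> coincide with the disk
      of \<open>contracting_phase\<close>.\<close>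
    have "v (b - a') * A ^ (N + 3) \<le> A\<^sup>2 \<longleftrightarrow> v (b - a') * A ^ Suc N \<le> 1" for b
    proof -
      have "v (b - a') * A ^ (N + 3) = (v (b - a') * A ^ Suc N) * A\<^sup>2"
        by (simp add: power_add power2_eq_square power3_eq_cube)
      then have "v (b - a') * A ^ (N + 3) \<le> A\<^sup>2 \<longleftrightarrow> v (b - a') * A ^ Suc N * A\<^sup>2 \<le> 1 * A\<^sup>2"
        by (simp only: mult_1)
      also have "\<dots> \<longleftrightarrow> v (b - a') * A ^ Suc N \<le> 1"
        using v_a0 by (intro mult_le_cancel_right_pos) simp
      finally show ?thesis .
    qed
    then show ?thesis unfolding good_def using contracting(2) va' a'(2) N by (simp add: m_def)
  qed
  moreover have "itinerary n N M b" if b: "v (b - a') * A ^ Suc N \<le> 1" for b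
  proof -
    have "v (b - a) * A ^ N < A\<^sup>2" using near[OF b] A2 by simp
    then have "v (F (n + j) b - 1) < 1" if "j < N" for j
      using expanding_phase_near_one[OF good that] expanding_phase[OF good N _ _ , of b a j] that v_a0
      by simp
    then show ?thesis unfolding itinerary_def using contracting(1)[of b] b N by (simp add: m_def)
  qed
  ultimately show ?thesis
    using \<open>0 < M\<close> \<open>\<sigma> ^ M * A ^ (N + 4) < 1\<close> a'a by (meson less_imp_le)
qed

section \<open>Initial parameter and passage to the limit\<close>

lemma good_one_a0: "good N 1 a0"
proof -
  \<comment> \<open>At time 1 only one change of parameter has acted, and A |x|^p = 1 gives the
    distance for all \<open>b\<close>, \<open>c\<close>; hence \<open>N\<close> is
    arbitrary.\<close>
  have "A * v (F 1 b - F 1 c) = v (b - c)" for b c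
    using f_diff_param_small[OF v_x_less, of b c] v_x_power by (simp add: F_def mult_ac)
  then show ?thesis by (simp add: good_def F_def f_x)
qed

text \<open>The parameters differ from stage \<open>i\<close> on by at most A^(2 - N i), so they
  converge. Each itinerary is prescribed on a whole disk that contains the limit.\<close>

lemma ex_parameter:
  assumes complete: "complete_wrt v" and "0 < \<epsilon>"
  obtains a N n M where "v (a - a0) \<le> \<epsilon>" "v a = A" "n 0 = 1" "\<And>i. i < N i" "\<And>i. 0 < M i"
    "\<And>i. n (Suc i) = n i + N i + M i" "\<And>i. \<sigma> ^ M i * A ^ (N (Suc i) + 1) \<le> 1"
    "\<And>i. itinerary (n i) (N i) (M i) a"
proof -
  \<comment> \<open>Ensures A^(2 - N0) < \<epsilon>, which bounds the total displacement from
    \<open>a0\<close>.\<close>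
  obtain N0 where N0: "A\<^sup>2 / \<epsilon> < A ^ N0" using real_arch_pow[OF v_a0] by blast
  define N where "N i = N0 + 3 + 3 * i" for i
  \<comment> \<open>The clause for \<open>i = 0\<close> records the starting pair, as dependent
    choice yields only some initial state.\<close>
  define P where "P i s \<longleftrightarrow> good (N i) (snd s) (fst s) \<and> (i = 0 \<longrightarrow> s = (a0, 1))"
    for i :: nat and s :: "'a \<times> nat"
  define Q where "Q i s t \<longleftrightarrow> v (fst t - fst s) * A ^ N i \<le> A\<^sup>2 \<and>
    (\<exists>M>0. snd t = snd s + N i + M \<and> \<sigma> ^ M * A ^ (N i + 4) \<le> 1 \<and>
      (\<forall>b. v (b - fst t) * A ^ Suc (N i) \<le> 1 \<longrightarrow> itinerary (snd s) (N i) M b))"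
    for i and s t :: "'a \<times> nat"
  have "\<exists>g. \<forall>i. P i (g i) \<and> Q i (g i) (g (Suc i))"
  proof (rule dependent_nat_choice)
    show "\<exists>s. P 0 s" using good_one_a0 by (intro exI[of _ "(a0, 1)"]) (simp add: P_def)
    fix s i assume "P i s"
    then have "good (N i) (snd s) (fst s)" "3 \<le> N i" by (auto simp: P_def N_def)
    from ex_next_parameter[OF this] obtain a' M where "0 < M" "good (N i + 3) (snd s + N i + M) a'"
      "\<sigma> ^ M * A ^ (N i + 4) \<le> 1" "v (a' - fst s) * A ^ N i \<le> A\<^sup>2"
      "\<forall>b. v (b - a') * A ^ Suc (N i) \<le> 1 \<longrightarrow> itinerary (snd s) (N i) M b" by blast
    moreover have "N (Suc i) = N i + 3" by (simp add: N_def)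
    ultimately show "\<exists>t. P (Suc i) t \<and> Q i s t"
      by (intro exI[of _ "(a', snd s + N i + M)"]) (auto simp: P_def Q_def)
  qed
  then obtain g where P: "\<And>i. P i (g i)" and Q: "\<And>i. Q i (g i) (g (Suc i))" by blast
  define al n where "al i = fst (g i)" and "n i = snd (g i)" for i
  have g0: "al 0 = a0" "n 0 = 1" using P[of 0] by (auto simp: P_def al_def n_def)
  obtain M where M: "\<And>i. M i > 0" "\<And>i. n (Suc i) = n i + N i + M i"
    "\<And>i. \<sigma> ^ M i * A ^ (N i + 4) \<le> 1"
    "\<And>i b. v (b - al (Suc i)) * A ^ Suc (N i) \<le> 1 \<Longrightarrow> itinerary (n i) (N i) (M i) b"
    using Q unfolding Q_def al_def n_def by metis
  have near: "v (al (i + k) - al i) * A ^ N i \<le> A\<^sup>2" for i k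
  proof (induction k)
    case (Suc k)
    have "v (al (Suc (i + k)) - al (i + k)) * A ^ N i \<le> v (al (Suc (i + k)) - al (i + k)) * A ^ N (i + k)"
      using v_a0 by (intro mult_left_mono power_increasing) (auto simp: nonneg N_def)
    also have "\<dots> \<le> A\<^sup>2" using Q[of "i + k"] by (simp add: Q_def al_def)
    finally have 1: "v (al (Suc (i + k)) - al (i + k)) * A ^ N i \<le> A\<^sup>2" .
    have "v (al (Suc (i + k)) - al i) * A ^ N i
        \<le> max (v (al (Suc (i + k)) - al (i + k))) (v (al (i + k) - al i)) * A ^ N i"
      using v_diff_triangle v_a0 by (intro mult_right_mono) auto
    also have "\<dots> \<le> A\<^sup>2" using 1 Suc by (simp add: max_def)
    finally show ?case by simp
  qed (use v_a0 in simp)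
  interpret MS: Metric_space UNIV "\<lambda>x y. v (x - y)" by (rule Metric_space_v)
  have tail: "\<exists>i. A\<^sup>2 < e * A ^ N i" if "0 < e" for e
  proof -
    obtain i where "A\<^sup>2 / e < A ^ i" using real_arch_pow[OF v_a0] by blast
    also have "A ^ i \<le> A ^ N i" using v_a0 by (intro power_increasing) (auto simp: N_def)
    finally show ?thesis using that by (auto simp: field_simps)
  qed
  have "MS.MCauchy al"
    unfolding MS.MCauchy_def
  proof (intro conjI allI impI)
    fix e :: real assume "0 < e"
    then obtain i where i: "A\<^sup>2 < e * A ^ N i" using tail by blast
    have *: "v (al j - al i) < e" if j: "i \<le> j" for j
    proof -
      have "v (al j - al i) * A ^ N i < e * A ^ N i" using near[of i "j - i"] i j by simp
      then show ?thesis using v_a0 by simp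
    qed
    have "v (al j - al k) < e" if "i \<le> j" "i \<le> k" for j k
      using v_diff_triangle[of "al j" "al k" "al i"] *[OF that(1)] *[OF that(2)]
      by (simp add: v_diff_commute)
    then show "\<exists>N. \<forall>n n'. N \<le> n \<longrightarrow> N \<le> n' \<longrightarrow> v (al n - al n') < e" by blast
  qed auto
  then obtain a where lim: "limitin MS.mtopology al a sequentially"
    using complete unfolding complete_wrt_def MS.mcomplete_def by blast
  have a: "v (a - al i) * A ^ N i \<le> A\<^sup>2" for i
  proof -
    have "0 < A\<^sup>2 / A ^ N i" using v_a0 by simp
    then obtain K where "\<forall>j\<ge>K. v (al j - a) < A\<^sup>2 / A ^ N i"
      using lim unfolding MS.limit_metric_sequentially by meson
    then have "v (al (i + K) - a) < A\<^sup>2 / A ^ N i" by simp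
    then have "v (a - al (i + K)) * A ^ N i < A\<^sup>2" using v_a0 by (simp add: field_simps v_diff_commute)
    moreover have "v (a - al i) * A ^ N i \<le> max (v (a - al (i + K))) (v (al (i + K) - al i)) * A ^ N i"
      using v_diff_triangle v_a0 by (intro mult_right_mono) auto
    ultimately show ?thesis using near[of i K] by (simp add: max_def split: if_splits)
  qed
  have "v (a - a0) * A ^ N 0 \<le> A\<^sup>2" using a[of 0] g0 by simp
  then have va: "v a = A" by (rule param_modulus[of a0, rotated 2]) (auto simp: N_def)
  have "v (a - a0) * A ^ N0 \<le> v (a - a0) * A ^ N 0"
    using v_a0 by (intro mult_left_mono power_increasing) (auto simp: N_def nonneg)
  then have "v (a - a0) * A ^ N0 \<le> A\<^sup>2" using \<open>v (a - a0) * A ^ N 0 \<le> A\<^sup>2\<close> by simp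
  also have "\<dots> \<le> \<epsilon> * A ^ N0" using N0 \<open>0 < \<epsilon>\<close> by (simp add: field_simps)
  finally have close: "v (a - a0) \<le> \<epsilon>" using v_a0 by simp
  have "itinerary (n i) (N i) (M i) a" for i
  proof (rule M(4))
    \<comment> \<open>The disk known to contain the limit, of radius A^(2 - N (Suc i)), is exactly
      the one on which itinerary \<open>i\<close> holds.\<close>
    have "N (Suc i) = Suc (N i) + 2" by (simp add: N_def)
    then have "v (a - al (Suc i)) * A ^ Suc (N i) * A\<^sup>2 = v (a - al (Suc i)) * A ^ N (Suc i)"
      by (simp only: power_add mult.assoc)
    then have "v (a - al (Suc i)) * A ^ Suc (N i) * A\<^sup>2 \<le> 1 * A\<^sup>2" using a[of "Suc i"] by linarith
    then show "v (a - al (Suc i)) * A ^ Suc (N i) \<le> 1" by (rule mult_right_le_imp_le) (use v_a0 in simp)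
  qed
  moreover have "\<sigma> ^ M i * A ^ (N (Suc i) + 1) \<le> 1" for i
  proof -
    have "N (Suc i) + 1 = N i + 4" by (simp add: N_def)
    then show ?thesis using M(3)[of i] by metis
  qed
  moreover have "i < N i" for i by (simp add: N_def)
  ultimately show ?thesis using that[of a n N M] close va g0(2) M(1,2) by blast
qed

text \<open>Along a run near 1 the distance to the orbit of \<open>x\<close> grows by at most A per
  step; during the following \<open>M i\<close> steps the relative distance contracts by \<sigma>.
  The size of \<open>M i\<close> pays in advance for the next run, so the bound \<open>start\<close>
  recurs in every block.\<close>

lemma orbits_near_x_bounded:
  assumes va: "v a = A" and n0: "n 0 = 1" and N: "\<And>i. i < N i" and M: "\<And>i. 0 < M i"
    and n_Suc: "\<And>i. n (Suc i) = n i + N i + M i"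
    and M_large: "\<And>i. \<sigma> ^ M i * A ^ (N (Suc i) + 1) \<le> 1"
    and it: "\<And>i. itinerary (n i) (N i) (M i) a"
    and y: "v (y - x) * A ^ (N 0 + 2) \<le> \<sigma>"
  shows "v ((f a ^^ k) y) \<le> 1"
proof -
  define Y s where "Y k = (f a ^^ k) y" and "s k = v (Y k - F k a)" for k
  have Y_Suc: "Y (Suc k) = f a (Y k)" for k by (simp add: Y_def)
  have one: "v (F (n i) a) = 1" for i
    using it[of i] N[of i] v_near_one[of "F (n i) a"] by (force simp: itinerary_def)
  have X1: "v (F (n i + j) a) = 1" if "j < N i" for i j
    using it[of i] that v_near_one[of "F (n i + j) a"] by (simp add: itinerary_def)
  have X2: "1 / A < v (F (n i + N i + j) a)" "v (F (n i + N i + j) a) \<le> v x" if "j < M i" for i j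
    using it[of i] that by (auto simp: itinerary_def)
  have Y_le: "v (Y k) \<le> 1" if "s k \<le> 1" "v (F k a) \<le> 1" for k
    using ultrametric[of "Y k - F k a" "F k a"] that by (simp add: s_def)
  have s_nonneg: "0 \<le> s k" for k by (simp add: s_def nonneg)
  \<comment> \<open>Of the \<open>N i + 1\<close> available factors A one is spent per step; the one
    left over gives distance at most \<sigma> / A at the end of the run.\<close>
  have phase1: "s (n i + j) * A ^ (N i - j + 1) \<le> \<sigma>"
    if "s (n i) * A ^ (N i + 1) \<le> \<sigma>" "j \<le> N i" for i j
    using that(2)
  proof (induction j)
    case (Suc j)
    then have IH: "s (n i + j) * A ^ (N i - j + 1) \<le> \<sigma>" by simp
    moreover have "s (n i + j) * 1 \<le> s (n i + j) * A ^ (N i - j + 1)"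
      using v_a0 s_nonneg by (intro mult_left_mono one_le_power) auto
    ultimately have "s (n i + j) \<le> 1" using sigma_less_1 by simp
    then have "s (Suc (n i + j)) \<le> A * s (n i + j)"
      unfolding s_def Y_Suc F_Suc using X1[of j i] Suc.prems va
      by (intro f_lipschitz Y_le) (auto simp: s_def)
    then have "s (n i + Suc j) * A ^ (N i - Suc j + 1) \<le> A * s (n i + j) * A ^ (N i - Suc j + 1)"
      using v_a0 by (intro mult_right_mono) auto
    also have "\<dots> = s (n i + j) * A ^ (N i - j + 1)"
    proof -
      have "N i - j + 1 = Suc (N i - Suc j + 1)" using Suc.prems by simp
      then show ?thesis by (simp add: mult_ac)
    qed
    finally show ?case using IH by simp
  qed (use that in simp)
  have phase2: "s (n i + N i + j) \<le> \<sigma> ^ Suc j * v (F (n i + N i + j) a)"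
    if "s (n i) * A ^ (N i + 1) \<le> \<sigma>" "j \<le> M i" for i j
    using that(2)
  proof (induction j)
    case 0
    have "s (n i + N i) \<le> \<sigma> * (1 / A)" using phase1[OF that(1), of "N i"] v_a0 by (simp add: field_simps)
    \<comment> \<open>The lower bound 1 / A in \<open>itinerary\<close> turns the absolute bound
      into a relative one.\<close>
    also have "\<dots> \<le> \<sigma> * v (F (n i + N i) a)"
      using X2(1)[OF M, of i] sigma_pos by (intro mult_left_mono) auto
    finally show ?case by simp
  next
    case (Suc j)
    define z w where "z = F (n i + N i + j) a" and "w = Y (n i + N i + j)"
    have z: "v z \<le> v x" using X2(2)[of j i] Suc.prems by (simp add: z_def)
    have IH: "v (w - z) \<le> \<sigma> ^ Suc j * v z" using Suc by (simp add: z_def w_def s_def)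
    also have "\<dots> \<le> \<sigma> * v z"
      using sigma_pos sigma_less_1 power_decreasing[of 1 "Suc j" \<sigma>]
      by (intro mult_right_mono) (auto simp: nonneg)
    finally have "v (f a w - f a z) \<le> \<sigma> * v (w - z) * (A * v z ^ (p - 1))"
      using z v_x_le_sigma sigma_less_1 by (intro f_contract va v_p_le_sigma) auto
    also have "\<dots> \<le> \<sigma> * (\<sigma> ^ Suc j * v z) * (A * v z ^ (p - 1))"
      using IH sigma_pos v_a0 by (intro mult_right_mono mult_left_mono) (auto simp: nonneg)
    also have "\<dots> = \<sigma> ^ Suc (Suc j) * (A * v z ^ p)"
      using p_ge_2 by (cases p) auto
    also have "A * v z ^ p = v (f a z)" using v_f_small[OF va, of z] z v_x_less by simp
    finally show ?case by (simp add: s_def Y_Suc F_Suc z_def w_def)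
  qed
  have start: "s (n i) * A ^ (N i + 1) \<le> \<sigma>" for i
  proof (induction i)
    case 0
    have "v (y - x) * 1 \<le> v (y - x) * A ^ (N 0 + 2)"
      using v_a0 nonneg by (intro mult_left_mono one_le_power) auto
    then have "v (y - x) \<le> 1" using y sigma_less_1 by simp
    then have "v y \<le> 1" using ultrametric[of "y - x" x] v_x_less by simp
    \<comment> \<open>The step from time 0 to \<open>n 0 = 1\<close> costs one factor A, hence the
      exponent \<open>N 0 + 2\<close> for \<open>y\<close>.\<close>
    then have "s 1 \<le> A * v (y - x)"
      using f_lipschitz[OF va, of y x] v_x_less by (simp add: s_def Y_def F_def)
    then have "s 1 * A ^ (N 0 + 1) \<le> A * v (y - x) * A ^ (N 0 + 1)"
      using v_a0 by (intro mult_right_mono) auto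
    then show ?case using y by (simp add: n0 mult_ac)
  next
    case (Suc i)
    have "s (n (Suc i)) \<le> \<sigma> ^ Suc (M i)"
      using phase2[OF Suc, of "M i"] one[of "Suc i"] by (simp add: n_Suc)
    then have "s (n (Suc i)) * A ^ (N (Suc i) + 1) \<le> \<sigma> * (\<sigma> ^ M i * A ^ (N (Suc i) + 1))"
      using v_a0 mult_right_mono[of "s (n (Suc i))" "\<sigma> ^ Suc (M i)" "A ^ (N (Suc i) + 1)"]
      by (simp add: mult_ac)
    also have "\<dots> \<le> \<sigma>" using mult_left_mono[OF M_large[of i], of \<sigma>] sigma_pos by simp
    finally show ?case .
  qed
  have bound1: "v (Y (n i + j)) \<le> 1" if "j < N i" for i j
  proof (rule Y_le)
    have "s (n i + j) * 1 \<le> s (n i + j) * A ^ (N i - j + 1)"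
      using v_a0 s_nonneg by (intro mult_left_mono one_le_power) auto
    then show "s (n i + j) \<le> 1" using phase1[OF start, of j i] that sigma_less_1 by simp
  qed (use X1[OF that] in simp)
  have bound2: "v (Y (n i + N i + j)) \<le> 1" if "j < M i" for i j
  proof (rule Y_le)
    show X: "v (F (n i + N i + j) a) \<le> 1" using X2(2)[OF that] v_x_less by simp
    have "\<sigma> ^ Suc j * v (F (n i + N i + j) a) \<le> 1 * 1"
      using X sigma_pos sigma_less_1 by (intro mult_mono power_le_one) (auto simp: nonneg)
    then show "s (n i + N i + j) \<le> 1" using phase2[OF start, of j i] that by simp
  qed
  have cover: "\<exists>i j. Suc k = n i + j \<and> j < N i + M i" for k
  proof (induction k)
    case 0
    show ?case using N[of 0] by (intro exI[of _ 0]) (simp add: n0)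
  next
    case (Suc k)
    then obtain i j where ij: "Suc k = n i + j" "j < N i + M i" by blast
    show ?case
    proof (cases "Suc j < N i + M i")
      case True
      then show ?thesis using ij by (intro exI[of _ i] exI[of _ "Suc j"]) simp
    next
      case False
      then have "Suc (Suc k) = n (Suc i) + 0" using ij n_Suc[of i] by simp
      then show ?thesis using N[of "Suc i"] by (metis add_gr_0 gr_zeroI not_less_zero)
    qed
  qed
  have "v (Y k) \<le> 1"
  proof (cases k)
    case 0
    have "v (y - x) * 1 \<le> v (y - x) * A ^ (N 0 + 2)"
      using v_a0 nonneg by (intro mult_left_mono one_le_power) auto
    then have "v (y - x) \<le> 1" using y sigma_less_1 by simp
    then show ?thesis using ultrametric[of "y - x" x] v_x_less by (simp add: Y_def 0)
  next
    case (Suc l)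
    then obtain i j where ij: "k = n i + j" "j < N i + M i" using cover[of l] by auto
    show ?thesis
    proof (cases "j < N i")
      case True
      then show ?thesis using bound1 ij by simp
    next
      case False
      then have "k = n i + N i + (j - N i)" "j - N i < M i" using ij by auto
      then show ?thesis using bound2 by metis
    qed
  qed
  then show ?thesis by (simp add: Y_def)
qed

end

section \<open>Fatou components\<close>

lemma poly_map_iterate: "(poly_map q ^^ n) (Fin z) = Fin ((poly q ^^ n) z)"
  by (induction n) auto

context nonarch_absolute_value
begin

lemma spherical_dist_le: "spherical_dist v (Fin y) (Fin z) \<le> v (y - z)"
proof -
  have "1 * 1 \<le> max (v y) 1 * max (v z) 1" by (intro mult_mono) auto
  then have "v (y - z) * 1 \<le> v (y - z) * (max (v y) 1 * max (v z) 1)"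
    by (intro mult_left_mono) (auto simp: nonneg)
  then show ?thesis using \<open>1 * 1 \<le> max (v y) 1 * max (v z) 1\<close> by (simp add: divide_le_eq)
qed

text \<open>Points outside the closed unit disk, including infinity, have spherical distance 1 from
  all points in it; inside, the spherical metric is |y - z|.\<close>

lemma spherical_dist_less_1:
  assumes "v y \<le> 1" "spherical_dist v (Fin y) w < \<delta>" "\<delta> \<le> 1"
  obtains z where "w = Fin z" "v z \<le> 1" "v (y - z) < \<delta>"
proof (cases w)
  case (Fin z)
  have "v z \<le> 1"
  proof (rule ccontr)
    assume "\<not> v z \<le> 1"
    then have "v (y - z) = v z" using v_diff_eq_right[of y z] assms(1) by simp
    then show False using assms \<open>\<not> v z \<le> 1\<close> by (simp add: Fin max_def)
  qed
  then show ?thesis using that assms Fin by (simp add: max_def)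
next
  case Infty
  then show ?thesis using assms by (simp add: max_def)
qed

end

section \<open>Disks in the Fatou set and the component around a point\<close>

context wild_family
begin

lemma iterate_poly:
  assumes "v a = A"
  obtains q where "0 < degree q" "poly q = f a ^^ n"
proof -
  have "\<exists>q. 0 < degree q \<and> poly q = f a ^^ n"
  proof (induction n)
    case 0
    show ?case by (intro exI[of _ "[:0, 1:]"]) (auto simp: fun_eq_iff)
  next
    case (Suc n)
    then obtain q where "0 < degree q" "poly q = f a ^^ n" by blast
    then show ?case
      using degree_phi[OF assms]
      by (intro exI[of _ "pcompose (phi p a) q"])
        (auto simp: degree_pcompose poly_pcompose poly_phi fun_eq_iff)
  qed
  then show ?thesis using that by blast
qed

lemma infinite_disk:
  assumes "0 < \<delta>" shows "infinite {z. v (z - y) < \<delta>}"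
proof -
  obtain k where k: "1 / \<delta> < A ^ k" using real_arch_pow[OF v_a0] by blast
  define g where "g i = y + 1 / a0 ^ (k + i)" for i
  have "inj g"
  proof (rule injI)
    fix i j assume "g i = g j"
    then have "v (1 / a0 ^ (k + i)) = v (1 / a0 ^ (k + j))" by (simp add: g_def)
    then have "A ^ (k + i) = A ^ (k + j)" by (simp add: v_divide v_power)
    then show "i = j" using v_a0 by (simp add: power_inject_exp)
  qed
  moreover have "v (g i - y) < \<delta>" for i
  proof -
    have "A ^ k \<le> A ^ (k + i)" using v_a0 by (intro power_increasing) auto
    then have "1 / \<delta> < A ^ (k + i)" using k by simp
    then show ?thesis using assms v_a0 by (simp add: g_def v_divide v_power field_simps)
  qed
  then have "range g \<subseteq> {z. v (z - y) < \<delta>}" by auto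
  ultimately show ?thesis using infinite_super range_inj_infinite by blast
qed

text \<open>Arbitrarily close to \<open>y\<close> there are points not mapped to 1 by the n-th
  iterate. Equicontinuity would keep their later images in the open unit disk around 1, where
  distances from 1 grow by the factor A forever.\<close>

lemma preimage_of_one_in_julia:
  assumes a: "v a = A" and y: "(f a ^^ n) y = 1"
  shows "Fin y \<in> julia_set v (poly_map (phi p a))"
proof (rule ccontr)
  assume "Fin y \<notin> julia_set v (poly_map (phi p a))"
  then have "equicontinuous_iterates_at v (poly_map (phi p a)) (Fin y)"
    by (simp add: julia_set_def fatou_set_def)
  then obtain \<delta> where "\<delta> > 0" and \<delta>: "\<And>z k. spherical_dist v (Fin y) (Fin z) < \<delta> \<Longrightarrow>
      spherical_dist v (Fin ((f a ^^ k) y)) (Fin ((f a ^^ k) z)) < 1"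
    unfolding equicontinuous_iterates_at_def poly_phi[symmetric] poly_map_iterate[symmetric]
    by (meson zero_less_one)
  obtain q where q: "0 < degree q" "poly q = f a ^^ n" using iterate_poly[OF a] by blast
  have "q - 1 \<noteq> 0" using q(1) by auto
  then have "finite {z. poly (q - 1) z = 0}" by (rule poly_roots_finite)
  then have "infinite ({z. v (z - y) < \<delta>} - {z. poly (q - 1) z = 0})"
    using infinite_disk[OF \<open>\<delta> > 0\<close>] by (rule Diff_infinite_finite)
  then have "{z. v (z - y) < \<delta>} - {z. poly (q - 1) z = 0} \<noteq> {}" by (rule infinite_imp_nonempty)
  then obtain z where z: "v (z - y) < \<delta>" "(f a ^^ n) z \<noteq> 1" by (auto simp: q(2))
  have "spherical_dist v (Fin y) (Fin z) < \<delta>"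
    using spherical_dist_le[of y z] z(1) by (simp add: v_diff_commute)
  note close = \<delta>[OF this]
  have fix_one: "(f a ^^ (k + n)) y = 1" for k
    by (induction k) (use y in auto)
  have near: "v ((f a ^^ (k + n)) z - 1) < 1" for k
    using close[of "k + n"] unfolding fix_one
    by (rule spherical_dist_less_1[rotated]) (auto simp: v_diff_commute)
  have grow: "v ((f a ^^ (k + n)) z - 1) = A ^ k * v ((f a ^^ n) z - 1)" for k
  proof (induction k)
    case (Suc k)
    then show ?case using f_expand[OF a near[of k], of 1] by simp
  qed simp
  have pos: "0 < v ((f a ^^ n) z - 1)" using z(2) by (simp add: v_pos_iff)
  obtain k where "1 / v ((f a ^^ n) z - 1) < A ^ k" using real_arch_pow[OF v_a0] by blast
  then show False using near[of k] grow[of k] pos by (simp add: field_simps)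
qed

text \<open>An iterate with values of modulus at most 1 and above 1 on the disk would also take the
  value 1, giving a Julia point in the disk.\<close>

lemma fatou_disk_orbits_bounded:
  assumes a: "v a = A" and x: "\<And>n. v ((f a ^^ n) x) \<le> 1"
    and disk: "closed_disk v x r \<subseteq> fatou_set v (poly_map (phi p a))" and y: "v (y - x) \<le> r"
  shows "v ((f a ^^ n) y) \<le> 1"
proof (rule ccontr)
  assume neg: "\<not> ?thesis"
  obtain q where q: "poly q = f a ^^ n" using iterate_poly[OF a] by blast
  have "v (1 - poly q x) \<le> 1" using v_diff_le[of 1 "poly q x"] x[of n] by (simp add: q)
  also have "1 < v (poly q y - poly q x)"
    using neg v_diff_eq_left[of "poly q x" "poly q y"] x[of n] by (simp add: q)
  finally obtain z where z: "v (z - x) \<le> v (y - x)" "poly q z = 1" using poly_disk_image by blast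
  then have "Fin z \<in> julia_set v (poly_map (phi p a))"
    using preimage_of_one_in_julia[OF a, of n z] by (simp add: q)
  moreover have "Fin z \<in> closed_disk v x r" using z y by (auto simp: closed_disk_def)
  ultimately show False using disk by (auto simp: julia_set_def)
qed

text \<open>The Schwarz lemma on disks of radius \<open>r\<close> gives all iterates the same
  Lipschitz constant 1 / r.\<close>

lemma disk_in_fatou:
  assumes a: "v a = A" and "0 < r"
    and bounded: "\<And>y n. v (y - x) \<le> r \<Longrightarrow> v ((f a ^^ n) y) \<le> 1"
  shows "closed_disk v x r \<subseteq> fatou_set v (poly_map (phi p a))"
proof
  fix w assume "w \<in> closed_disk v x r"
  then obtain y where w: "w = Fin y" and y: "v (y - x) \<le> r" by (auto simp: closed_disk_def)
  have y_disk: "v (z - x) \<le> r" if "v (z - y) \<le> r" for z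
    using v_diff_triangle[of z x y] that y by simp
  have vy: "v y \<le> 1" using bounded[OF y, of 0] by simp
  show "w \<in> fatou_set v (poly_map (phi p a))"
    unfolding w fatou_set_def mem_Collect_eq equicontinuous_iterates_at_def
  proof (intro allI impI)
    fix e :: real assume "0 < e"
    show "\<exists>\<delta>>0. \<forall>w. spherical_dist v (Fin y) w < \<delta> \<longrightarrow>
        (\<forall>n. spherical_dist v ((poly_map (phi p a) ^^ n) (Fin y)) ((poly_map (phi p a) ^^ n) w) < e)"
    \<comment> \<open>The bound 1 keeps \<open>w\<close> in the unit disk, \<open>r\<close> keeps it
      in the given disk, and \<open>e * r\<close> matches the Lipschitz constant.\<close>
    proof (intro exI[of _ "min 1 (min r (e * r))"] conjI allI impI)
      fix w and n :: nat assume "spherical_dist v (Fin y) w < min 1 (min r (e * r))"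
      then obtain z where z: "w = Fin z" "v (y - z) < min 1 (min r (e * r))"
        by (rule spherical_dist_less_1[OF vy]) auto
      then have zy: "v (z - y) \<le> r" "v (z - y) < e * r" by (auto simp: v_diff_commute)
      obtain q where q: "poly q = f a ^^ n" using iterate_poly[OF a] by blast
      have "v (poly q z - poly q y) \<le> v (z - y) / r"
        using bounded y_disk by (intro poly_schwarz_lemma[OF v_a0 \<open>0 < r\<close> _ zy(1)]) (simp add: q)
      also have "\<dots> < e" using zy(2) \<open>0 < r\<close> by (simp add: field_simps)
      finally have "v ((f a ^^ n) y - (f a ^^ n) z) < e" by (simp add: q v_diff_commute)
      then show "spherical_dist v ((poly_map (phi p a) ^^ n) (Fin y)) ((poly_map (phi p a) ^^ n) w) < e"
        unfolding z(1) poly_map_iterate poly_phi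
        using spherical_dist_le[of "(f a ^^ n) y" "(f a ^^ n) z"] by linarith
    qed (use \<open>0 < r\<close> \<open>0 < e\<close> in auto)
  qed
qed

text \<open>The radius is the supremum of those for which all orbits stay in the unit disk. It is
  attained, because a polynomial value of modulus above 1 on the closed disk also occurs in the open
  one; maximality is \<open>fatou_disk_orbits_bounded\<close>.\<close>

lemma ex_fatou_component:
  assumes a: "v a = A" and "0 < r0"
    and bounded: "\<And>y n. v (y - x) \<le> r0 \<Longrightarrow> v ((f a ^^ n) y) \<le> 1"
  shows "\<exists>r>0. is_fatou_component_at v (phi p a) x (closed_disk v x r)"
proof -
  define S where "S = {r. \<forall>y n. v (y - x) \<le> r \<longrightarrow> v ((f a ^^ n) y) \<le> 1}"
  have x_bounded: "v ((f a ^^ n) x) \<le> 1" for n using bounded[of x n] \<open>0 < r0\<close> by simp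
  have r0: "r0 \<in> S" using bounded by (simp add: S_def)
  have S_D: "v ((f a ^^ n) y) \<le> 1" if "r \<in> S" "v (y - x) \<le> r" for r y n
    using that unfolding S_def by blast
  have le_A: "r \<le> A" if "r \<in> S" for r
  proof (rule ccontr)
    assume "\<not> r \<le> A"
    then have "v (x + a0) \<le> 1" using S_D[OF that, of "x + a0" 0] by simp
    moreover have "v (a0 + x) = A"
      using v_add_eq_left[of x a0] x_bounded[of 0] v_a0 by simp
    ultimately show False using v_a0 by (simp add: add.commute)
  qed
  define r where "r = Sup S"
  have bdd: "bdd_above S" by (rule bdd_aboveI) (rule le_A)
  have le_r: "s \<le> r" if "s \<in> S" for s unfolding r_def using that bdd by (rule cSup_upper)
  have "0 < r" using le_r[OF r0] \<open>0 < r0\<close> by simp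
  have inner: "v ((f a ^^ n) y) \<le> 1" if less: "v (y - x) < r" for y n
  proof -
    have "S \<noteq> {}" using r0 by blast
    then obtain s where "s \<in> S" "v (y - x) < s"
      using less less_cSup_iff[OF _ bdd, of "v (y - x)"] unfolding r_def by blast
    then show ?thesis using S_D[of s y n] by simp
  qed
  have "r \<in> S"
    unfolding S_def mem_Collect_eq
  proof (intro allI impI, rule ccontr)
    fix y n assume y: "v (y - x) \<le> r" and neg: "\<not> v ((f a ^^ n) y) \<le> 1"
    obtain q where q: "poly q = f a ^^ n" using iterate_poly[OF a] by blast
    have "1 < v (poly q y)" using neg by (simp add: q)
    then obtain z where "v (z - x) < r" "1 < v (poly q z)"
      using poly_approx_near_boundary[OF v_a0 \<open>0 < r\<close> y \<open>0 < r\<close>] by blast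
    then show False using inner[of z n] by (simp add: q)
  qed
  have fatou: "closed_disk v x r \<subseteq> fatou_set v (poly_map (phi p a))"
    using \<open>r \<in> S\<close> by (intro disk_in_fatou[OF a \<open>0 < r\<close>]) (rule S_D)
  have "is_fatou_component_at v (phi p a) x (closed_disk v x r)"
    unfolding is_fatou_component_at_def
  proof (intro conjI allI impI)
    show "2 \<le> degree (phi p a)" using degree_phi[OF a] p_ge_2 by simp
    show "julia_set v (poly_map (phi p a)) \<noteq> {}"
      using preimage_of_one_in_julia[OF a, of 0 1] by auto
    show "Fin x \<in> fatou_set v (poly_map (phi p a))"
      using fatou \<open>0 < r\<close> by (auto simp: closed_disk_def)
    show "bounded_orbit v (phi p a) x"
      unfolding bounded_orbit_def poly_phi using x_bounded by blast
    show "\<exists>s>0. closed_disk v x r = closed_disk v x s" using \<open>0 < r\<close> by blast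
    show "closed_disk v x r \<subseteq> fatou_set v (poly_map (phi p a))" by (rule fatou)
  next
    fix s :: real assume "0 < s" "closed_disk v x s \<subseteq> fatou_set v (poly_map (phi p a))"
    then have "s \<in> S" using fatou_disk_orbits_bounded[OF a x_bounded] by (auto simp: S_def)
    then show "closed_disk v x s \<subseteq> closed_disk v x r"
      using le_r[of s] by (auto simp: closed_disk_def)
  qed
  with \<open>0 < r\<close> show ?thesis by blast
qed

text \<open>An image of the disk meeting both the open unit disk around 1 and its complement would
  contain 1. Hence membership in that open disk gives a symbolic coding that is constant on the
  component.\<close>

lemma fatou_disk_same_side:
  assumes a: "v a = A" and x: "\<And>n. v ((f a ^^ n) x) \<le> 1"
    and disk: "closed_disk v x r \<subseteq> fatou_set v (poly_map (phi p a))" and y: "v (y - x) \<le> r"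
  shows "v ((f a ^^ n) y - 1) < 1 \<longleftrightarrow> v ((f a ^^ n) x - 1) < 1"
proof (rule ccontr)
  assume neg: "\<not> ?thesis"
  obtain q where q: "poly q = f a ^^ n" using iterate_poly[OF a] by blast
  have "\<exists>z. v (z - x) \<le> r \<and> poly q z = 1"
  proof (cases "v ((f a ^^ n) x - 1) < 1")
    case True
    then have "v (poly q x - 1) < v (poly q y - 1)" using neg by (simp add: q)
    then have "v (poly q y - poly q x) = v (poly q y - 1)"
      using v_diff_eq_of_close[of 1 "poly q x" "poly q y"] by (simp add: v_diff_commute)
    then have "v (1 - poly q x) < v (poly q y - poly q x)"
      using \<open>v (poly q x - 1) < v (poly q y - 1)\<close> by (simp add: v_diff_commute)
    then show ?thesis using poly_disk_image[of 1 q x y] y by (meson order_trans)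
  next
    \<comment> \<open>The disk is recentred at \<open>y\<close>, whose image is the one close to
      1.\<close>
    case False
    then have less: "v (poly q y - 1) < v (poly q x - 1)" using neg by (simp add: q)
    then have "v (poly q x - poly q y) = v (poly q x - 1)"
      using v_diff_eq_of_close[of 1 "poly q y" "poly q x"] by (simp add: v_diff_commute)
    then have "v (1 - poly q y) < v (poly q x - poly q y)" using less by (simp add: v_diff_commute)
    then obtain z where z: "v (z - y) \<le> v (x - y)" "poly q z = 1"
      using poly_disk_image[of 1 q y x] by blast
    then have "v (z - x) \<le> r" using v_diff_triangle[of z x y] y v_diff_commute[of x y] by linarith
    with z(2) show ?thesis by blast
  qed
  then obtain z where z: "v (z - x) \<le> r" "(f a ^^ n) z = 1" by (auto simp: q)
  then have "Fin z \<in> julia_set v (poly_map (phi p a))" using preimage_of_one_in_julia[OF a] by blast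
  moreover have "Fin z \<in> closed_disk v x r" using z by (auto simp: closed_disk_def)
  ultimately show False using disk by (auto simp: julia_set_def)
qed

end

text \<open>A run longer than the period that ends after the preperiod would have to continue past
  its end.\<close>

lemma long_runs_not_eventually_periodic:
  assumes runs: "\<And>i j. j < N i \<Longrightarrow> S (n i + j)" and stops: "\<And>i. \<not> S (n i + N i)"
    and N: "\<And>i. i < N i" and n: "\<And>i::nat. i \<le> n i"
    and q: "0 < q" and periodic: "\<And>k. m \<le> k \<Longrightarrow> S (k + q) = S (k::nat)"
  shows False
proof -
  define i where "i = m + q"
  have "S (n i + N i - q + q) = S (n i + N i - q)"
    using n[of i] by (intro periodic) (simp add: i_def)
  moreover have "q < N i" using N[of i] by (simp add: i_def)
  then have "S (n i + (N i - q))" using q by (intro runs) simp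
  ultimately show False using stops[of i] \<open>q < N i\<close> by simp
qed

theorem mainTheorem1:
  fixes v :: "'a::alg_closed_field \<Rightarrow> real" and p :: nat and a0 :: 'a and \<epsilon> :: real
  assumes "nonarch_absolute_value v"
    and "complete_wrt v"
    and "ring_characteristic (residue_field v) = p" and "p > 0"
    and "v a0 > 1" and "\<epsilon> > 0"
  shows "\<exists>a. v (a - a0) \<le> \<epsilon> \<and> has_wandering_component v (phi p a)"
proof -
  interpret nonarch_absolute_value v by fact
  have dvd: "p dvd k \<longleftrightarrow> v (of_nat k) < 1" for k
    using residue_characteristic_dvd_iff[of k] assms(3) by simp
  \<comment> \<open>Divisibility by \<open>p\<close> means absolute value below 1, so primality
    follows from multiplicativity and |k| \<le> 1 for integers.\<close>
  have "prime p"
  proof (rule prime_natI)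
    show "2 \<le> p"
    proof (rule ccontr)
      assume "\<not> 2 \<le> p"
      then have "p = 1" using \<open>p > 0\<close> by simp
      then show False using dvd[of 1] by simp
    qed
    fix k l assume "p dvd k * l"
    then have "v (of_nat k) * v (of_nat l) < 1" using dvd[of "k * l"] by (simp add: mult)
    then have "v (of_nat k) < 1 \<or> v (of_nat l) < 1"
      using v_of_nat_le_one[of k] v_of_nat_le_one[of l] by fastforce
    then show "p dvd k \<or> p dvd l" by (simp add: dvd)
  qed
  moreover have "v (of_nat p) < 1" using dvd[of p] by simp
  ultimately interpret wild_family v p a0 by unfold_locales (use assms(5) in auto)
  obtain x where "f a0 x = 1" "v x < 1" "v a0 * v x ^ p = 1" using ex_preimage_of_one by blast
  then interpret wild_orbit v p a0 x by unfold_locales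
  obtain a N n M where close: "v (a - a0) \<le> \<epsilon>" and va: "v a = v a0" and n0: "n 0 = 1"
    and N: "\<And>i. i < N i" and M: "\<And>i. 0 < M i" and n_Suc: "\<And>i. n (Suc i) = n i + N i + M i"
    and M_large: "\<And>i. \<sigma> ^ M i * v a0 ^ (N (Suc i) + 1) \<le> 1"
    and it: "\<And>i. itinerary (n i) (N i) (M i) a"
    by (rule ex_parameter[OF assms(2,6)]) blast
  define r0 where "r0 = \<sigma> / v a0 ^ (N 0 + 2)"
  have "0 < r0" using sigma_pos v_a0 by (simp add: r0_def)
  have bounded: "v ((f a ^^ k) y) \<le> 1" if "v (y - x) \<le> r0" for y k
    using that v_a0
    by (intro orbits_near_x_bounded[OF va n0 N M n_Suc M_large it]) (simp add: r0_def field_simps)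
  then have x_bounded: "v ((f a ^^ k) x) \<le> 1" for k using \<open>0 < r0\<close> by simp
  obtain r where r: "0 < r" "is_fatou_component_at v (phi p a) x (closed_disk v x r)"
    using ex_fatou_component[OF va \<open>0 < r0\<close> bounded] by blast
  then have disk: "closed_disk v x r \<subseteq> fatou_set v (poly_map (phi p a))"
    by (simp add: is_fatou_component_at_def)
  define S where "S k \<longleftrightarrow> v ((f a ^^ k) x - 1) < 1" for k
  have image: "(poly_map (phi p a) ^^ k) ` closed_disk v x r = Fin ` (f a ^^ k) ` {z. v (z - x) \<le> r}" for k
    by (simp add: closed_disk_def image_image poly_map_iterate poly_phi)
  \<comment> \<open>If two images of the component agree, an orbit point of \<open>x\<close> is also
    an image of some \<open>y\<close> in the component, and \<open>y\<close> has the same coding as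
    \<open>x\<close>.\<close>
  have S_eq: "S (i + k) = S (j + k)"
    if eq: "(poly_map (phi p a) ^^ i) ` closed_disk v x r = (poly_map (phi p a) ^^ j) ` closed_disk v x r" for i j k
  proof -
    have "(f a ^^ i) ` {z. v (z - x) \<le> r} = (f a ^^ j) ` {z. v (z - x) \<le> r}"
      using eq unfolding image by (simp add: inj_image_eq_iff inj_def)
    moreover have "x \<in> {z. v (z - x) \<le> r}" using r(1) by simp
    ultimately obtain y where y: "v (y - x) \<le> r" "(f a ^^ i) x = (f a ^^ j) y"
      by (metis (no_types, lifting) image_iff mem_Collect_eq)
    then have "(f a ^^ (k + i)) x = (f a ^^ (k + j)) y" by (simp add: funpow_add)
    then show ?thesis
      unfolding S_def using fatou_disk_same_side[OF va x_bounded disk y(1), of "j + k"]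
      by (simp add: add.commute)
  qed
  have n_ge: "i \<le> n i" for i
  proof (induction i)
    case (Suc i)
    then show ?case using M[of i] n_Suc[of i] by simp
  qed simp
  have runs: "S (n i + j)" if "j < N i" for i j
    using it[of i] that by (simp add: itinerary_def S_def F_def)
  have stops: "\<not> S (n i + N i)" for i
  proof
    assume "S (n i + N i)"
    then have "v (F (n i + N i) a) = 1" using v_near_one by (simp add: S_def F_def)
    then show False using it[of i] M[of i] v_x_less by (force simp: itinerary_def dest: spec[of _ 0])
  qed
  \<comment> \<open>Equal images at times \<open>i\<close> and \<open>j\<close> would make the
    coding periodic with period \<open>j - i\<close> from time \<open>i\<close> on.\<close>
  have distinct: False
    if "i < j" and eq: "(poly_map (phi p a) ^^ i) ` closed_disk v x r = (poly_map (phi p a) ^^ j) ` closed_disk v x r" for i j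
  proof (rule long_runs_not_eventually_periodic[of N S n "j - i" i, OF runs stops N n_ge])
    fix k assume "i \<le> k"
    then show "S (k + (j - i)) = S k" using S_eq[OF eq, of "k - i"] \<open>i < j\<close> by (simp add: add.commute)
  qed (use \<open>i < j\<close> in auto)
  have "wandering (phi p a) (closed_disk v x r)"
    unfolding wandering_def using distinct by (metis nat_neq_iff)
  then show ?thesis using close r(2) by (auto simp: has_wandering_component_def)
qed

end
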